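(* For each $r$ in the set $\{29$, $33$, $37$, $40$, $45$, $49$, $52$, $53$, $60$, $61$, $65$, $69$, $77$, $80$, $81$, $85$, $93$, $97$, $100$, $101$, $108$, $109$, $117$, $120$, $125$, $133$, $140$, $141$, $149$, $157$, $160$, $165$, $173$, $180\}$ there exists a pentagonal geometry $\mathrm{PENT}(4,r)$ with no opposite line pairs whose deficiency graph is connected and has girth at least $5$.
   Context: A partial linear space is a non-empty finite set of points together with a collection of subsets, called lines (or blocks), such that every line contains at least two points and any two distinct points lie together on at most one line. Two distinct points are collinear if some line contains both. For integers $k \ge 2$, $r \ge 1$, a pentagonal geometry $\mathrm{PENT}(k,r)$ is a partial linear space in which every line contains exactly $k$ points, every point lies on exactly $r$ lines, and for each point $x$ there is a line, denoted $x^{\mathrm{opp}}$, consisting of precisely those points $y \ne x$ that are not collinear with $x$. An opposite line pair is an unordered pair of disjoint lines such that for each point $x$ on one of the two lines, $x^{\mathrm{opp}}$ is the other line. The deficiency graph of a pentagonal geometry has the points as vertices, with an edge joining distinct points $x$ and $y$ precisely when $x$ and $y$ are not collinear. *)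

theory Defs
  imports "Graph_Theory.Graph_Theory" "HOL-Library.Extended_Nat"
begin

locale partial_linear_space =
  fixes P :: "'a set" and L :: "'a set set"
  assumes finite_points: "finite P"
    and points_nonempty: "P \<noteq> {}"
    and line_subset: "l \<in> L \<Longrightarrow> l \<subseteq> P"
    and line_card: "l \<in> L \<Longrightarrow> card l \<ge> 2"
    and at_most_one_line:
      "\<lbrakk>l \<in> L; m \<in> L; x \<noteq> y; x \<in> l; y \<in> l; x \<in> m; y \<in> m\<rbrakk> \<Longrightarrow> l = m"

definition collinear_points :: "'a set set \<Rightarrow> 'a \<Rightarrow> 'a \<Rightarrow> bool" where
  "collinear_points L x y \<longleftrightarrow> x \<noteq> y \<and> (\<exists>l\<in>L. x \<in> l \<and> y \<in> l)"

definition opp :: "'a set \<Rightarrow> 'a set set \<Rightarrow> 'a \<Rightarrow> 'a set" where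
  "opp P L x = {y \<in> P. y \<noteq> x \<and> \<not> collinear_points L x y}"

locale pentagonal_geometry = partial_linear_space P L
  for P :: "'a set" and L :: "'a set set" +
  fixes k r :: nat
  assumes k_ge_2: "k \<ge> 2"
    and r_ge_1: "r \<ge> 1"
    and line_size: "l \<in> L \<Longrightarrow> card l = k"
    and point_degree: "x \<in> P \<Longrightarrow> card {l \<in> L. x \<in> l} = r"
    and opp_line: "x \<in> P \<Longrightarrow> opp P L x \<in> L"

definition opposite_line_pair :: "'a set \<Rightarrow> 'a set set \<Rightarrow> 'a set \<Rightarrow> 'a set \<Rightarrow> bool" where
  "opposite_line_pair P L l m \<longleftrightarrow>
     l \<in> L \<and> m \<in> L \<and> l \<inter> m = {} \<and> (\<forall>x\<in>l. opp P L x = m) \<and> (\<forall>x\<in>m. opp P L x = l)"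

text \<open>Undirected graphs are represented as symmetric digraphs: every edge gives two arcs.\<close>

definition deficiency_graph :: "'a set \<Rightarrow> 'a set set \<Rightarrow> ('a, 'a \<times> 'a) pre_digraph" where
  "deficiency_graph P L = with_proj
     \<lparr>pverts = P,
      parcs = {(x, y). x \<in> P \<and> y \<in> P \<and> x \<noteq> y \<and> \<not> collinear_points L x y}\<rparr>"

text \<open>
  Girth of a simple graph given as a symmetric digraph. In that representation
  \<^const>\<open>pre_digraph.cycle\<close> also admits the closed walk \<open>a, b, a\<close> along a single edge;
  requiring length at least 3 leaves exactly the cycles of the undirected graph.
  For an acyclic graph the infimum of the empty set is \<open>\<infinity>\<close>.
\<close>

definition girth :: "('a, 'b) pre_digraph \<Rightarrow> enat" where
  "girth G = (INF p \<in> {p. pre_digraph.cycle G p \<and> length p \<ge> 3}. enat (length p))"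

lemma deficiency_graph_simps [simp]:
  "verts (deficiency_graph P L) = P"
  "(x, y) \<in> arcs (deficiency_graph P L) \<longleftrightarrow>
     x \<in> P \<and> y \<in> P \<and> x \<noteq> y \<and> \<not> collinear_points L x y"
  "tail (deficiency_graph P L) = fst"
  "head (deficiency_graph P L) = snd"
  by (simp_all add: deficiency_graph_def)

lemma graph_deficiency_graph:
  assumes "finite P"
  shows "graph (deficiency_graph P L)"
proof -
  let ?G = "deficiency_graph P L"
  have sub: "arcs ?G \<subseteq> P \<times> P"
    by (auto simp: deficiency_graph_def)
  have "finite (arcs ?G)"
    using sub finite_subset assms by blast
  then have 1: "fin_digraph_axioms ?G"
    using assms by (simp add: fin_digraph_axioms_def)
  have 2: "wf_digraph ?G"
    using sub by (auto simp: wf_digraph_def)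
  have 3: "loopfree_digraph_axioms ?G"
    by (auto simp: loopfree_digraph_axioms_def)
  have 4: "nomulti_digraph_axioms ?G"
    by (auto simp: nomulti_digraph_axioms_def arc_to_ends_def)
  have "symmetric ?G"
    by (auto simp: deficiency_graph_def symmetric_def sym_def collinear_points_def)
  then have 5: "sym_digraph_axioms ?G"
    by (simp add: sym_digraph_axioms_def)
  show ?thesis
    using 1 2 3 4 5
    by (simp add: graph_def digraph_def pseudo_graph_def fin_digraph_def
        loopfree_digraph_def nomulti_digraph_def sym_digraph_def)
qed

end

theory Submission
  imports Defs "HOL-Library.Tree" "HOL-Library.Code_Binary_Nat"
begin

text \<open>
  The number of points is forced to be \<open>v = 3 r + 5\<close>. If \<open>x \<mapsto> x\<^sup>opp\<close> is injective, then
  there are no opposite line pairs and the girth is at least 5: on an opposite line pair this map is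
  constant on a line, the vertices of a 4-cycle give two distinct opposite lines sharing two points,
  and triangles are impossible because the neighbours of a point form a line.

  The geometries are difference families: the points are the integers modulo \<open>v\<close>, and the lines are
  the translates, by the multiples of a small divisor \<open>t\<close> of \<open>v\<close>, of a list of base blocks which
  contains \<open>x\<^sup>opp\<close> for \<open>x < t\<close>. Being a pentagonal geometry then means that every translation orbit
  of ordered pairs of distinct points is met exactly once, either by a base block or by an arc of
  the deficiency graph.
\<close>

section \<open>Geometries with injective opposition\<close>

text \<open>The full cyclic group cannot be used: for \<open>t = 1\<close>, symmetry of
  non-collinearity gives \<open>0\<^sup>opp\<close> the form \<open>{a, b, -a, -b}\<close>, and its
  pairs \<open>(a, b)\<close> and \<open>(-b, -a)\<close> have the same difference, so one orbit
  would be met twice. Classes modulo some \<open>t > 1\<close> separate such pairs; in every family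
  \<open>t\<close> is the least prime factor of \<open>v\<close>. There are
  \<open>t * (v - 1)\<close> orbits of ordered pairs. The arcs account for \<open>4 * t\<close> of
  them, each full block for 12 and each short one for 6, so \<open>t * r\<close> is four times the
  number of full blocks plus twice the number of short ones. If \<open>r\<close> is 1 modulo 4, then
  \<open>v\<close> is a multiple of 4, \<open>t = 2\<close>, and \<open>t * r\<close> is 2 modulo 4,
  which forces an odd number of short blocks; one suffices. In the other cases \<open>r\<close> is a
  multiple of 4, \<open>v\<close> is odd, no translation has order 2, and all blocks are full, with
  \<open>t\<close> equal to 5 or 7.\<close>

locale opp_injective =
  fixes P :: "nat set" and L :: "nat set set" and r :: nat
  assumes finite_P: "finite P" and card_P: "card P = 3 * r + 5" and r_pos: "r \<ge> 1"
    and line_sub: "l \<in> L \<Longrightarrow> l \<subseteq> P"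
    and line_4: "l \<in> L \<Longrightarrow> card l = 4"
    and line_unique: "\<lbrakk>l \<in> L; m \<in> L; x \<noteq> y; x \<in> l; y \<in> l; x \<in> m; y \<in> m\<rbrakk> \<Longrightarrow> l = m"
    and opp_in_L: "x \<in> P \<Longrightarrow> opp P L x \<in> L"
    and inj_opp: "inj_on (opp P L) P"
    and opp_descends: "x \<in> P \<Longrightarrow> x \<noteq> 0 \<Longrightarrow> \<exists>y\<in>opp P L x. y < x"
begin

lemma opp_iff: "y \<in> opp P L x \<longleftrightarrow> y \<in> P \<and> y \<noteq> x \<and> \<not> (\<exists>l\<in>L. x \<in> l \<and> y \<in> l)"
  by (auto simp: opp_def collinear_points_def)

lemma opp_sym: "x \<in> P \<Longrightarrow> y \<in> opp P L x \<Longrightarrow> x \<in> opp P L y"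
  by (auto simp: opp_iff)

lemma finite_lines: "finite L"
  using line_sub finite_P by (meson PowI finite_Pow_iff finite_subset subsetI)

text \<open>The lines through \<open>x\<close>, with \<open>x\<close> removed, are disjoint triples
  covering the points collinear with \<open>x\<close>. Together with \<open>x\<close> and the four
  points of \<open>x\<^sup>opp\<close> they exhaust \<open>P\<close>, so
  \<open>card P = 1 + 4 + 3 * d\<close> for the degree \<open>d\<close>.\<close>

lemma degree:
  assumes x: "x \<in> P"
  shows "card {l \<in> L. x \<in> l} = r"
proof -
  let ?Lx = "{l \<in> L. x \<in> l}"
  have fin: "finite l" if "l \<in> L" for l
    using that line_sub finite_P finite_subset by blast
  have disj: "(l - {x}) \<inter> (m - {x}) = {}" if "l \<in> ?Lx" "m \<in> ?Lx" "l \<noteq> m" for l m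
    using that line_unique by (simp add: disjoint_iff) metis
  let ?U = "\<Union>l\<in>?Lx. l - {x}"
  have "card ?U = (\<Sum>l\<in>?Lx. card (l - {x}))"
    using finite_lines fin disj by (intro card_UN_disjoint) auto
  also have "\<dots> = (\<Sum>l\<in>?Lx. 3)"
    using line_4 fin by (intro sum.cong) auto
  finally have U: "card ?U = 3 * card ?Lx"
    by simp
  have "P = insert x (opp P L x \<union> ?U)"
    using x line_sub by (auto simp: opp_iff)
  then have "card P = card (insert x (opp P L x \<union> ?U))"
    by (rule arg_cong)
  also have "\<dots> = Suc (card (opp P L x \<union> ?U))"
    using fin finite_lines opp_in_L[OF x] by (intro card_insert_disjoint) (auto simp: opp_iff)
  also have "card (opp P L x \<union> ?U) = card (opp P L x) + card ?U"
    using fin finite_lines opp_in_L[OF x] by (intro card_Un_disjoint) (auto simp: opp_iff)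
  finally have "card P = Suc (4 + 3 * card ?Lx)"
    using U line_4[OF opp_in_L[OF x]] by simp
  then show ?thesis
    using card_P by simp
qed

lemma pentagonal: "pentagonal_geometry P L 4 r"
proof
  show "finite P" "P \<noteq> {}"
    using finite_P card_P by auto
qed (use line_sub line_4 line_unique opp_in_L r_pos degree in \<open>auto\<close>)

lemma no_opposite_line_pair: "\<not> opposite_line_pair P L l m"
proof
  assume opp: "opposite_line_pair P L l m"
  then have l: "l \<in> L" and "\<forall>x\<in>l. opp P L x = m"
    by (auto simp: opposite_line_pair_def)
  then have "\<forall>x\<in>l. \<forall>y\<in>l. x = y"
    using inj_opp line_sub[OF l] by (metis inj_onD subsetD)
  \<comment> \<open>An infinite \<open>l\<close> is covered as well, because its \<open>card\<close>
    is 0 by convention.\<close>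
  then have "card l \<le> 1"
    by (metis One_nat_def card.infinite card_le_Suc0_iff_eq zero_le_one)
  then show False
    using line_4[OF l] by simp
qed

text \<open>Every point other than 0 has a smaller neighbour, so descent leads from each point to 0.
  Connectedness is defined as strong connectedness of the symmetric closure, and this digraph is
  already symmetric.\<close>

lemma connected: "Digraph_Component.connected (deficiency_graph P L)"
proof -
  let ?G = "deficiency_graph P L"
  interpret graph ?G
    by (rule graph_deficiency_graph[OF finite_P])
  have step: "x \<rightarrow>\<^bsub>?G\<^esub> y" if "x \<in> P" "y \<in> opp P L x" for x y
    using that by (intro in_arcs_imp_in_arcs_ends[of "(x, y)", simplified]) (auto simp: opp_def)
  have to_0: "x \<rightarrow>\<^sup>*\<^bsub>?G\<^esub> 0" if "x \<in> P" for x
    using that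
  proof (induction x rule: less_induct)
    case (less x)
    show ?case
    proof (cases "x = 0")
      case True
      then show ?thesis using less.prems by auto
    next
      case False
      then obtain y where y: "y \<in> opp P L x" "y < x"
        using opp_descends less.prems by blast
      then have "y \<in> P" by (simp add: opp_iff)
      then show ?thesis
        using less.IH y step[OF less.prems y(1)] by (meson adj_reachable_trans)
    qed
  qed
  have "x \<rightarrow>\<^sup>*\<^bsub>?G\<^esub> y" if "x \<in> P" "y \<in> P" for x y
    using to_0 that symmetric_reachable[OF sym_arcs] reachable_trans by blast
  moreover have "P \<noteq> {}"
    using card_P by auto
  ultimately have "strongly_connected (mk_symmetric ?G)"
    by (auto simp: strongly_connected_def reachable_mk_symmetric_eq[OF sym_arcs])
  then show ?thesis
    by (simp add: Digraph_Component.connected_def)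
qed

text \<open>Excludes triangles: \<open>a\<close> and \<open>b\<close> lie on the common line
  \<open>x\<^sup>opp\<close>, hence are equal or collinear.\<close>

lemma opp_no_edge: "x \<in> P \<Longrightarrow> a \<in> opp P L x \<Longrightarrow> b \<in> opp P L x \<Longrightarrow> b \<notin> opp P L a"
  using opp_in_L[of x] by (auto simp: opp_iff[of b a])

lemma opp_common:
  assumes "x \<in> P" "y \<in> P" "a \<noteq> b" "{a, b} \<subseteq> opp P L x" "{a, b} \<subseteq> opp P L y"
  shows "x = y"
  using line_unique[OF opp_in_L opp_in_L] assms inj_onD[OF inj_opp] by (metis insert_subset)

lemma girth_ge_5: "girth (deficiency_graph P L) \<ge> 5"
  unfolding girth_def
proof (rule INF_greatest)
  fix p assume "p \<in> {p. pre_digraph.cycle (deficiency_graph P L) p \<and> length p \<ge> 3}"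
  then obtain u where len: "length p \<ge> 3"
    and walk: "pre_digraph.awalk (deficiency_graph P L) u p u"
    and dist: "distinct (tl (pre_digraph.awalk_verts (deficiency_graph P L) u p))"
    by (auto simp: pre_digraph.cycle_def)
  note [simp] = pre_digraph.cas.simps pre_digraph.awalk_verts.simps pre_digraph.awalk_def
  have "length p \<noteq> 3"
  proof
    assume "length p = 3"
    then obtain e f g where "p = [e, f, g]"
      by (auto simp: length_Suc_conv numeral_3_eq_3)
    \<comment> \<open>In a walk the head of each arc is the tail of the next, so only the vertices
      remain free.\<close>
    with walk obtain a b where p: "p = [(u, a), (a, b), (b, u)]"
      by (cases e; cases f; cases g) auto
    have "u \<in> P" "a \<in> opp P L u" "b \<in> opp P L a" "u \<in> opp P L b" "b \<in> P"
      using walk by (auto simp: p opp_def)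
    then show False
      using opp_no_edge opp_sym by blast
  qed
  moreover have "length p \<noteq> 4"
  proof
    assume "length p = 4"
    then obtain e f g h where "p = [e, f, g, h]"
      by (auto simp: length_Suc_conv eval_nat_numeral)
    with walk obtain a b c where p: "p = [(u, a), (a, b), (b, c), (c, u)]"
      by (cases e; cases f; cases g; cases h) auto
    \<comment> \<open>The vertex list is \<open>[u, a, b, c, u]\<close>, and distinctness of its
      tail yields both inequalities. Thus \<open>u\<close> and \<open>b\<close> are two points with
      the common neighbours \<open>a\<close> and \<open>c\<close>.\<close>
    have "u \<in> P" "a \<in> P" "b \<in> P" "c \<in> P" "a \<noteq> c" "b \<noteq> u"
      and "a \<in> opp P L u" "b \<in> opp P L a" "c \<in> opp P L b" "u \<in> opp P L c"
      using walk dist by (auto simp: p opp_def)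
    then show False
      using opp_common[of u b a c] opp_sym by blast
  qed
  ultimately have "length p \<ge> 5"
    using len by linarith
  then show "5 \<le> enat (length p)"
    by (simp add: numeral_eq_enat)
qed

end

section \<open>Translations modulo v\<close>

text \<open>The residue of \<open>q - p\<close> modulo \<open>v\<close> for \<open>p, q < v\<close>;
  adding \<open>v\<close> before subtracting keeps natural subtraction from truncating.\<close>

definition diff_mod :: "nat \<Rightarrow> nat \<Rightarrow> nat \<Rightarrow> nat" where
  "diff_mod v p q = (if p \<le> q then q - p else q + v - p)"

text \<open>A complete invariant of the ordered pair under translation by multiples of
  \<open>t\<close>: the difference and the class of the first point, packed into one number. The
  possible keys of distinct points fill the interval from \<open>t\<close> to
  \<open>t * v - 1\<close>, so an exact cover becomes an equality of lists.\<close>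

definition orbit_key :: "nat \<Rightarrow> nat \<Rightarrow> nat \<Rightarrow> nat \<Rightarrow> nat" where
  "orbit_key v t p q = diff_mod v p q * t + p mod t"

definition shift :: "nat \<Rightarrow> nat \<Rightarrow> nat \<Rightarrow> nat" where
  "shift v g x = (x + g) mod v"

lemma shift_less: "0 < v \<Longrightarrow> shift v g x < v"
  by (simp add: shift_def)

lemma shift_shift: "shift v g (shift v h x) = shift v (h + g) x"
  by (simp add: shift_def mod_simps add.assoc)

lemma shift_diff_mod: "p < v \<Longrightarrow> q < v \<Longrightarrow> shift v (diff_mod v p q) p = q"
  by (auto simp: shift_def diff_mod_def)

lemma shift_mod: "t dvd v \<Longrightarrow> t dvd g \<Longrightarrow> shift v g x mod t = x mod t"
  by (auto simp: shift_def mod_mod_cancel elim!: dvdE)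

lemma diff_mod_shift:
  assumes "p < v" "q < v"
  shows "diff_mod v (shift v g p) (shift v g q) = diff_mod v p q"
proof -
  \<comment> \<open>Over the integers the case distinction disappears, and a common shift cancels in
    the difference.\<close>
  have "int (diff_mod v a b) = (int b - int a) mod int v" if "a < v" "b < v" for a b
  proof (cases "a \<le> b")
    case True
    then show ?thesis using that by (simp add: diff_mod_def of_nat_diff)
  next
    case False
    then have "(int b - int a) mod int v = (int b - int a + int v) mod int v"
      by simp
    also have "\<dots> = int b - int a + int v"
      using that False by (intro mod_pos_pos_trivial) auto
    finally show ?thesis using that False by (simp add: diff_mod_def of_nat_diff)
  qed
  moreover have "int (shift v g a) = (int a + int g) mod int v" for a
    by (simp add: shift_def zmod_int)
  ultimately have "int (diff_mod v (shift v g p) (shift v g q)) = int (diff_mod v p q)"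
    using assms shift_less[of v g] by (simp add: mod_simps)
  then show ?thesis by simp
qed

lemma orbit_key_shift:
  assumes "t dvd v" "t dvd g" "p < v" "q < v"
  shows "orbit_key v t (shift v g p) (shift v g q) = orbit_key v t p q"
  using assms by (simp add: orbit_key_def diff_mod_shift shift_mod)

text \<open>The converse of \<open>orbit_key_shift\<close>. The translation taking \<open>p\<close>
  to \<open>p'\<close> is by a multiple of \<open>t\<close> because the two residues agree, and it
  takes \<open>q\<close> to \<open>q'\<close> because a point is determined by its difference from
  \<open>p'\<close>.\<close>

lemma orbit_key_eqD:
  assumes "0 < t" "t dvd v" "p < v" "q < v" "p' < v" "q' < v"
    and eq: "orbit_key v t p q = orbit_key v t p' q'"
  obtains g where "t dvd g" "shift v g p = p'" "shift v g q = q'"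
proof
  let ?g = "diff_mod v p p'"
  have "orbit_key v t a b mod t = a mod t" "orbit_key v t a b div t = diff_mod v a b" for a b
    using \<open>0 < t\<close> by (simp_all add: orbit_key_def)
  with eq have m: "p mod t = p' mod t" and d: "diff_mod v p q = diff_mod v p' q'"
    by metis+
  show "t dvd ?g"
  proof (cases "p \<le> p'")
    case True
    then show ?thesis using m[symmetric] by (simp add: diff_mod_def mod_eq_dvd_iff_nat)
  next
    case False
    have "(p' + v) mod t = p mod t" using m \<open>t dvd v\<close> by (auto elim!: dvdE)
    then show ?thesis using False \<open>p < v\<close> by (simp add: diff_mod_def mod_eq_dvd_iff_nat)
  qed
  show p': "shift v ?g p = p'" using assms by (simp add: shift_diff_mod)
  have "diff_mod v p' (shift v ?g q) = diff_mod v p' q'"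
    using diff_mod_shift[of p v q ?g] p' d assms by simp
  moreover have "shift v ?g q < v" using assms by (intro shift_less) simp
  ultimately show "shift v ?g q = q'"
    using shift_diff_mod[of p' v] assms(5,6) by metis
qed

lemma shift_inj: "p < v \<Longrightarrow> q < v \<Longrightarrow> shift v g p = shift v g q \<Longrightarrow> p = q"
  using diff_mod_shift[of p v q g] by (auto simp: diff_mod_def split: if_splits)

lemma inj_on_shift: "inj_on (shift v g) {..<v}"
  by (metis inj_onI lessThan_iff shift_inj)

text \<open>Translations act freely: agreement at a single point already means that \<open>g\<close>
  and \<open>h\<close> are congruent modulo \<open>v\<close>.\<close>

lemma shift_eq_shift:
  assumes "shift v g p = shift v h p"
  shows "shift v g x = shift v h x"
proof -
  have *: "int (shift v k x) = (int (shift v k p) + (int x - int p)) mod int v" for k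
    unfolding shift_def zmod_int mod_add_left_eq by (simp add: add.commute)
  show ?thesis using *[of g] *[of h] assms by simp
qed

lemma orbit_key_range:
  "\<lbrakk>0 < t; p < v; q < v; p \<noteq> q\<rbrakk> \<Longrightarrow> t \<le> orbit_key v t p q \<and> orbit_key v t p q < t * v"
proof -
  assume *: "0 < t" "p < v" "q < v" "p \<noteq> q"
  let ?d = "diff_mod v p q"
  have "1 \<le> ?d" "Suc ?d \<le> v" using * by (auto simp: diff_mod_def)
  then have "1 * t \<le> ?d * t" "Suc ?d * t \<le> v * t" by (metis mult_le_mono1)+
  then have "t \<le> ?d * t" "?d * t + t \<le> t * v" by (simp_all add: mult.commute)
  moreover have "p mod t < t" using * by simp
  ultimately show ?thesis unfolding orbit_key_def by linarith
qed

section \<open>Families of base blocks\<close>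

text \<open>Equal keys go to the right instead of being merged, so that sorting preserves
  multiplicities and a repeated orbit is noticed.\<close>

primrec tree_insert :: "nat \<Rightarrow> nat tree \<Rightarrow> nat tree" where
  "tree_insert k Leaf = Node Leaf k Leaf"
| "tree_insert k (Node l x r) =
    (if k < x then Node (tree_insert k l) x r else Node l x (tree_insert k r))"

text \<open>
  Unconditional equations that branch on an argument keep the simplifier from normalising the
  subtrees again after every step, as it does for the branches of a conditional.
\<close>

definition tree_insert_if :: "bool \<Rightarrow> nat \<Rightarrow> nat tree \<Rightarrow> nat \<Rightarrow> nat tree \<Rightarrow> nat tree" where
  "tree_insert_if c k l x r =
    (if c then Node (tree_insert k l) x r else Node l x (tree_insert k r))"

lemma tree_insert_code [code]:
  "tree_insert k Leaf = Node Leaf k Leaf"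
  "tree_insert k (Node l x r) = tree_insert_if (k < x) k l x r"
  "tree_insert_if True k l x r = Node (tree_insert k l) x r"
  "tree_insert_if False k l x r = Node l x (tree_insert k r)"
  by (simp_all add: tree_insert_if_def)

primrec insert_all :: "nat list \<Rightarrow> nat tree \<Rightarrow> nat tree" where
  "insert_all [] s = s"
| "insert_all (x # xs) s = insert_all xs (tree_insert x s)"

definition tree_sort :: "nat list \<Rightarrow> nat list" where
  "tree_sort xs = inorder2 (insert_all xs Leaf) []"

text \<open>This is all that soundness takes: the output is compared with a concrete list, so a
  wrongly ordered result could only make \<open>valid_family\<close> fail.\<close>

lemma mset_tree_sort: "mset (tree_sort xs) = mset xs"
proof -
  have "mset (inorder (tree_insert k s)) = add_mset k (mset (inorder s))" for k s
    by (induction s) auto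
  then have "mset (inorder (insert_all xs s)) = mset xs + mset (inorder s)" for s
    by (induction xs arbitrary: s) auto
  then show ?thesis
    by (simp add: tree_sort_def inorder2_inorder)
qed

text \<open>These are the sets \<open>i\<^sup>opp\<close> for \<open>i < t\<close>, recovered from
  lists of differences. They serve as base blocks because each opposite set has to be a
  line.\<close>

definition opp_blocks :: "nat \<Rightarrow> nat list list \<Rightarrow> nat list list" where
  "opp_blocks v A = map (\<lambda>i. map (shift v i) (A ! i)) [0..<length A]"

text \<open>
  A short block is invariant under translation by \<open>v div 2\<close>, so only two of its points, the roots,
  may contribute pairs; in all other blocks every point is a root.
\<close>

definition short_block :: "nat \<Rightarrow> nat \<Rightarrow> nat \<Rightarrow> nat list" where
  "short_block v a c = [a, c, shift v (v div 2) a, shift v (v div 2) c]"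

definition rooted_blocks ::
  "nat \<Rightarrow> nat list list \<Rightarrow> nat list list \<Rightarrow> (nat \<times> nat) list \<Rightarrow> (nat list \<times> nat list) list" where
  "rooted_blocks v A B S =
    map (\<lambda>b. (b, b)) (opp_blocks v A @ B) @ map (\<lambda>(a, c). ([a, c], short_block v a c)) S"

text \<open>The block is kept beside the pair, so that distinctness of the keys says that a key
  determines both the pair and its block.\<close>

definition flags :: "(nat list \<times> nat list) list \<Rightarrow> (nat list \<times> nat \<times> nat) list" where
  "flags F = concat (map (\<lambda>(rs, b).
    concat (map (\<lambda>p. map (\<lambda>q. (b, p, q)) (filter (\<lambda>q. q \<noteq> p) b)) rs)) F)"

definition block_keys :: "nat \<Rightarrow> nat \<Rightarrow> (nat list \<times> nat list) list \<Rightarrow> nat list" where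
  "block_keys v t F = map (\<lambda>(b, p, q). orbit_key v t p q) (flags F)"

lemma block_keys_code [code]:
  "block_keys v t F = concat (map (\<lambda>(rs, b).
    concat (map (\<lambda>p. map (orbit_key v t p) (filter (\<lambda>q. q \<noteq> p) b)) rs)) F)"
  by (simp add: block_keys_def flags_def map_concat comp_def case_prod_unfold)

text \<open>The orbit keys of the arcs of the deficiency graph: \<open>d\<close> is the difference
  along the arc and \<open>i\<close> the class of its tail.\<close>

definition opp_keys :: "nat \<Rightarrow> nat list list \<Rightarrow> nat list" where
  "opp_keys t A = concat (map (\<lambda>i. map (\<lambda>d. d * t + i) (A ! i)) [0..<length A])"

text \<open>
  \<open>A ! i\<close> lists the differences \<open>y - x\<close> modulo \<open>v\<close> for the points \<open>y\<close> of \<open>x\<^sup>opp\<close>, where \<open>x mod t = i\<close>.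
  The condition with \<open>v \<le> d + \<dots>\<close> makes some point of \<open>x\<^sup>opp\<close> smaller than \<open>x\<close> unless \<open>x = 0\<close>, hence
  the deficiency graph connected.
\<close>

definition valid_family ::
  "nat \<Rightarrow> nat \<Rightarrow> nat list list \<Rightarrow> nat list list \<Rightarrow> (nat \<times> nat) list \<Rightarrow> bool" where
  "valid_family r t A B S \<longleftrightarrow> (let v = 3 * r + 5; F = rooted_blocks v A B S in
    0 < r \<and> 0 < t \<and> t dvd v \<and> length A = t \<and> (S \<noteq> [] \<longrightarrow> 2 * t dvd v) \<and>
    distinct (opp_blocks v A) \<and>
    list_all (\<lambda>(rs, b). length b = 4 \<and> distinct b \<and> list_all (\<lambda>x. x < v) b) F \<and>
    list_all (\<lambda>i. list_ex (\<lambda>d. v \<le> d + (if i = 0 then t else i)) (A ! i)) [0..<t] \<and>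
    tree_sort (opp_keys t A @ block_keys v t F) = [t..<t * v])"

section \<open>The geometry generated by a valid family\<close>

locale block_family =
  fixes r t :: nat and A B :: "nat list list" and S :: "(nat \<times> nat) list"
  assumes valid: "valid_family r t A B S"
begin

definition "v = 3 * r + 5"
abbreviation "F \<equiv> rooted_blocks v A B S"
abbreviation "\<tau> \<equiv> shift v"
abbreviation "\<kappa> \<equiv> orbit_key v t"

definition "L = {\<tau> g ` set b | g rs b. t dvd g \<and> (rs, b) \<in> set F}"

lemma r_pos: "0 < r" and t_pos: "0 < t" and t_dvd: "t dvd v" and length_A: "length A = t"
  and short_dvd: "S \<noteq> [] \<Longrightarrow> 2 * t dvd v"
  and distinct_opp_blocks: "distinct (opp_blocks v A)"
  and block: "(rs, b) \<in> set F \<Longrightarrow> length b = 4 \<and> distinct b \<and> set b \<subseteq> {..<v}"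
  and descends: "i < t \<Longrightarrow> \<exists>d\<in>set (A ! i). v \<le> d + (if i = 0 then t else i)"
  and sorted_keys: "tree_sort (opp_keys t A @ block_keys v t F) = [t..<t * v]"
  using valid
  by (auto simp: valid_family_def Let_def v_def[symmetric] list_all_iff list_ex_iff)

lemma v_pos: "0 < v"
  by (simp add: v_def)

lemma mset_keys: "mset (opp_keys t A @ block_keys v t F) = mset [t..<t * v]"
  using mset_tree_sort[of "opp_keys t A @ block_keys v t F"] sorted_keys by metis

text \<open>The packing half of the exact cover: two points lie on at most one line, and on none if
  they are joined by an arc.\<close>

lemma distinct_keys: "distinct (opp_keys t A @ block_keys v t F)"
  using mset_eq_imp_distinct_iff[OF mset_keys] by simp

text \<open>The covering half: points not joined by an arc do lie on a line.\<close>

lemma set_keys: "set (opp_keys t A) \<union> set (block_keys v t F) = {t..<t * v}"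
  using mset_eq_setD[OF mset_keys] by simp

lemma inj_flags: "inj_on (\<lambda>(b, p, q). \<kappa> p q) (set (flags F))"
  using distinct_keys by (simp add: block_keys_def distinct_map)

lemma flags_iff: "(b, p, q) \<in> set (flags F) \<longleftrightarrow>
    (\<exists>rs. (rs, b) \<in> set F \<and> p \<in> set rs \<and> q \<in> set b \<and> q \<noteq> p)"
  unfolding flags_def by (force simp: image_iff)

lemma roots_subset: "(rs, b) \<in> set F \<Longrightarrow> set rs \<subseteq> set b"
  by (auto simp: rooted_blocks_def short_block_def)

text \<open>Justifies taking pairs from the roots only: each point of a block is carried to by a
  root under a translation that fixes the block as a set.\<close>

lemma root_shift:
  assumes F: "(rs, b) \<in> set F" and p: "p \<in> set b"
  obtains g p0 where "t dvd g" "p0 \<in> set rs" "p = \<tau> g p0" "\<tau> g ` set b = set b"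
proof -
  have id: "\<tau> 0 x = x" if "x \<in> set b" for x
    using block[OF F] that by (auto simp: shift_def)
  show ?thesis
  proof (cases "p \<in> set rs")
    case True
    then show ?thesis using that[of 0 p] p id by simp
  next
    case False
    \<comment> \<open>A full block consists of roots, so a point that is no root belongs to a short
      block.\<close>
    then obtain a c where S: "(a, c) \<in> set S" "rs = [a, c]" "b = short_block v a c"
      using F p by (auto simp: rooted_blocks_def)
    let ?h = "v div 2"
    have "S \<noteq> []"
      using S(1) by auto
    then have "2 * t dvd v"
      by (rule short_dvd)
    \<comment> \<open>Divisibility of \<open>v\<close> by \<open>2 * t\<close> makes the half
      translation exact and a multiple of \<open>t\<close>, hence an admissible involution.\<close>
    then have h: "t dvd ?h" "?h + ?h = v" by (auto elim!: dvdE)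
    then have hh: "\<tau> ?h (\<tau> ?h x) = x" if "x < v" for x
      using that by (simp add: shift_shift) (simp add: shift_def)
    have lt: "a < v" "c < v"
      using block[OF F] S by (auto simp: short_block_def)
    obtain p0 where "p0 \<in> {a, c}" "p = \<tau> ?h p0"
      using p False S by (auto simp: short_block_def)
    then show ?thesis
      using that[of ?h p0] h hh lt S by (auto simp: short_block_def)
  qed
qed

lemma line_subset: "l \<in> L \<Longrightarrow> l \<subseteq> {..<v}"
  using v_pos by (auto simp: L_def shift_less)

lemma line_card: "l \<in> L \<Longrightarrow> card l = 4"
proof -
  assume "l \<in> L"
  then obtain g rs b where l: "l = \<tau> g ` set b" and F: "(rs, b) \<in> set F"
    by (auto simp: L_def)
  have "inj_on (\<tau> g) (set b)"
    using block[OF F] inj_on_shift inj_on_subset by blast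
  then show ?thesis
    using block[OF F] by (simp add: l card_image distinct_card)
qed

text \<open>Two points of a line form a translate of a flag whose first point is a root. This normal
  form makes the keys comparable in \<open>collinear_iff\<close> and
  \<open>line_unique\<close>.\<close>

lemma flagE:
  assumes l: "l \<in> L" and x: "x \<in> l" and y: "y \<in> l" and "x \<noteq> y"
  obtains g b p q where "t dvd g" "(b, p, q) \<in> set (flags F)" "l = \<tau> g ` set b"
    "x = \<tau> g p" "y = \<tau> g q" "p < v" "q < v"
proof -
  from l x obtain g rs b p where g: "t dvd g" and F: "(rs, b) \<in> set F"
    and l_eq: "l = \<tau> g ` set b" and p: "p \<in> set b" "x = \<tau> g p"
    by (auto simp: L_def)
  obtain k p0 where k: "t dvd k" "p0 \<in> set rs" "p = \<tau> k p0" "\<tau> k ` set b = set b"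
    using root_shift[OF F p(1)] .
  \<comment> \<open>Passing to the root changes the translation but not the line, because
    \<open>\<tau> k\<close> maps the block onto itself.\<close>
  have l_eq': "l = \<tau> (k + g) ` set b"
    using l_eq k(4) by (metis (no_types, lifting) image_cong image_image shift_shift)
  then obtain q where q: "q \<in> set b" "y = \<tau> (k + g) q"
    using y by auto
  have x_eq: "x = \<tau> (k + g) p0"
    using p k by (simp add: shift_shift)
  show ?thesis
  proof (rule that[OF _ _ l_eq' x_eq q(2)])
    show "t dvd k + g" using g k by simp
    show "(b, p0, q) \<in> set (flags F)"
      using F k q x_eq \<open>x \<noteq> y\<close> by (auto simp: flags_iff)
    show "p0 < v" "q < v"
      using block[OF F] roots_subset[OF F] k q by auto
  qed
qed

lemma flag_key: "(b, p, q) \<in> set (flags F) \<Longrightarrow> \<kappa> p q \<in> set (block_keys v t F)"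
  by (force simp: block_keys_def)

text \<open>Keys are split between blocks and arcs: disjointness gives one direction. For the other,
  a block key equal to that of \<open>(x, y)\<close> yields a translation carrying a pair of the
  block to \<open>(x, y)\<close>.\<close>

lemma collinear_iff:
  assumes "x < v" "y < v" "x \<noteq> y"
  shows "(\<exists>l\<in>L. x \<in> l \<and> y \<in> l) \<longleftrightarrow> \<kappa> x y \<notin> set (opp_keys t A)"
proof
  assume "\<exists>l\<in>L. x \<in> l \<and> y \<in> l"
  then obtain l where "l \<in> L" "x \<in> l" "y \<in> l" by blast
  then obtain g b p q where "t dvd g" "(b, p, q) \<in> set (flags F)" "x = \<tau> g p" "y = \<tau> g q"
    "p < v" "q < v"
    using flagE[of l x y] assms by metis
  then have "\<kappa> x y \<in> set (block_keys v t F)"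
    using flag_key by (simp add: orbit_key_shift t_dvd)
  then show "\<kappa> x y \<notin> set (opp_keys t A)"
    using distinct_keys by auto
next
  assume "\<kappa> x y \<notin> set (opp_keys t A)"
  then have "\<kappa> x y \<in> set (block_keys v t F)"
    using orbit_key_range[OF t_pos assms] set_keys by fastforce
  then obtain b p q where f: "(b, p, q) \<in> set (flags F)" and eq: "\<kappa> p q = \<kappa> x y"
    by (auto simp: block_keys_def)
  then obtain rs where F: "(rs, b) \<in> set F" and pq: "p \<in> set b" "q \<in> set b"
    using roots_subset by (auto simp: flags_iff)
  then obtain g where "t dvd g" "\<tau> g p = x" "\<tau> g q = y"
    using orbit_key_eqD[OF t_pos t_dvd _ _ assms(1,2) eq] block[OF F] by auto
  then show "\<exists>l\<in>L. x \<in> l \<and> y \<in> l"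
    using F pq by (auto simp: L_def)
qed

text \<open>The pair \<open>(x, y)\<close> has one key, so both lines come from the same flag. Their
  translations then agree at its root, hence everywhere.\<close>

lemma line_unique:
  assumes "l \<in> L" "m \<in> L" "x \<noteq> y" "x \<in> l" "y \<in> l" "x \<in> m" "y \<in> m"
  shows "l = m"
proof -
  obtain g b p q where 1: "t dvd g" "(b, p, q) \<in> set (flags F)" "l = \<tau> g ` set b"
    "x = \<tau> g p" "y = \<tau> g q" "p < v" "q < v"
    using flagE[of l x y] assms by metis
  obtain g' b' p' q' where 2: "t dvd g'" "(b', p', q') \<in> set (flags F)" "m = \<tau> g' ` set b'"
    "x = \<tau> g' p'" "y = \<tau> g' q'" "p' < v" "q' < v"
    using flagE[of m x y] assms by metis
  have "\<kappa> p q = \<kappa> p' q'"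
    using 1 2 t_dvd orbit_key_shift by metis
  then have "b = b'" "p = p'"
    using inj_onD[OF inj_flags, of "(b, p, q)" "(b', p', q')"] 1 2 by auto
  moreover have "\<tau> g p = \<tau> g' p"
    using 1 2 \<open>p = p'\<close> by metis
  then have "\<tau> g z = \<tau> g' z" for z
    by (rule shift_eq_shift)
  ultimately show ?thesis
    using 1(3) 2(3) by simp
qed

section \<open>Opposite lines of the generated geometry\<close>

lemma opp_keys_iff: "k \<in> set (opp_keys t A) \<longleftrightarrow> (\<exists>i<t. \<exists>d\<in>set (A ! i). k = d * t + i)"
  by (auto simp: opp_keys_def length_A)

text \<open>The bounds on the differences are read off from the interval of keys: a key in it has a
  quotient by \<open>t\<close> between 1 and \<open>v - 1\<close>.\<close>

lemma offset_less:
  assumes "i < t" "d \<in> set (A ! i)"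
  shows "0 < d" "d < v"
proof -
  have "d * t + i \<in> {t..<t * v}"
    using set_keys opp_keys_iff assms by blast
  then have *: "t \<le> d * t + i" "d * t + i < v * t"
    by (simp_all add: mult.commute)
  show "0 < d"
    using * \<open>i < t\<close> by (cases d) auto
  have "d * t < v * t"
    using * by linarith
  then show "d < v"
    by simp
qed

text \<open>By \<open>collinear_iff\<close>, opposition is membership of the key in
  \<open>opp_keys\<close>; division by \<open>t\<close> with remainder unpacks it into a difference
  and the class of \<open>x\<close>. Adding that difference to \<open>x\<close> is written
  \<open>\<tau> x d\<close>.\<close>

lemma opp_eq:
  assumes x: "x < v"
  shows "opp {..<v} L x = \<tau> x ` set (A ! (x mod t))" (is "_ = ?N")
proof -
  have key: "\<kappa> x y \<in> set (opp_keys t A) \<longleftrightarrow> diff_mod v x y \<in> set (A ! (x mod t))" for y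
  proof
    assume "\<kappa> x y \<in> set (opp_keys t A)"
    then obtain i d where "i < t" "d \<in> set (A ! i)" and eq: "\<kappa> x y = d * t + i"
      by (auto simp: opp_keys_iff)
    moreover have "\<kappa> x y mod t = x mod t" "\<kappa> x y div t = diff_mod v x y"
      using t_pos by (simp_all add: orbit_key_def)
    moreover have "(d * t + i) mod t = i" "(d * t + i) div t = d"
      using \<open>i < t\<close> by simp_all
    ultimately show "diff_mod v x y \<in> set (A ! (x mod t))" by simp
  next
    assume "diff_mod v x y \<in> set (A ! (x mod t))"
    then show "\<kappa> x y \<in> set (opp_keys t A)"
      using mod_less_divisor[OF t_pos, of x] unfolding opp_keys_iff orbit_key_def by blast
  qed
  have "y \<in> opp {..<v} L x \<longleftrightarrow> y \<in> ?N" for y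
  proof -
    have "y \<in> opp {..<v} L x \<longleftrightarrow> y < v \<and> y \<noteq> x \<and> diff_mod v x y \<in> set (A ! (x mod t))"
      using collinear_iff[OF x] key by (auto simp: opp_def collinear_points_def)
    also have "\<dots> \<longleftrightarrow> y \<in> ?N"
    proof
      assume "y < v \<and> y \<noteq> x \<and> diff_mod v x y \<in> set (A ! (x mod t))"
      then show "y \<in> ?N"
        using shift_diff_mod[OF x, of y] by (auto simp: shift_def add.commute intro!: rev_image_eqI)
    next
      assume "y \<in> ?N"
      then obtain d where d: "d \<in> set (A ! (x mod t))" "y = \<tau> x d" by auto
      have "x mod t < t" using t_pos by simp
      then have "0 < d" "d < v" using offset_less d by auto
      then have "y < v \<and> y \<noteq> x \<and> diff_mod v x y = d"
        using x v_pos d by (auto simp: shift_def diff_mod_def mod_if)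
      then show "y < v \<and> y \<noteq> x \<and> diff_mod v x y \<in> set (A ! (x mod t))"
        using d by simp
    qed
    finally show ?thesis .
  qed
  then show ?thesis by blast
qed

lemma opp_block:
  assumes "x < v"
  shows "opp {..<v} L x = \<tau> (x - x mod t) ` set (opp_blocks v A ! (x mod t))"
    and "(opp_blocks v A ! (x mod t), opp_blocks v A ! (x mod t)) \<in> set F"
proof -
  have i: "x mod t < length A" using length_A t_pos by simp
  then have nth: "opp_blocks v A ! (x mod t) = map (\<tau> (x mod t)) (A ! (x mod t))"
    by (simp add: opp_blocks_def)
  show "opp {..<v} L x = \<tau> (x - x mod t) ` set (opp_blocks v A ! (x mod t))"
    unfolding opp_eq[OF assms] nth by (simp add: image_image shift_shift)
  show "(opp_blocks v A ! (x mod t), opp_blocks v A ! (x mod t)) \<in> set F"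
    using i by (simp add: rooted_blocks_def opp_blocks_def)
qed

lemma opp_in_L: "x < v \<Longrightarrow> opp {..<v} L x \<in> L"
  using opp_block[of x] unfolding L_def by (blast intro: dvd_minus_mod)

text \<open>Two points \<open>a, c\<close> of a common opposite line give flags of the base blocks
  for \<open>x\<close> and \<open>y\<close> with the same key, hence the same flag. The blocks
  therefore coincide, so \<open>x\<close> and \<open>y\<close> agree modulo \<open>t\<close>; the
  translations agree at \<open>p\<close>, which identifies \<open>x\<close> with \<open>y\<close>.
  Every point of an opposite block is a root, so no change of root is involved.\<close>

lemma inj_opp: "inj_on (opp {..<v} L) {..<v}"
proof (rule inj_onI)
  fix x y assume "x \<in> {..<v}" "y \<in> {..<v}" and eq: "opp {..<v} L x = opp {..<v} L y"
  then have xy: "x < v" "y < v" by auto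
  let ?b = "\<lambda>z. opp_blocks v A ! (z mod t)"
  let ?g = "\<lambda>z. z - z mod t"
  have "card (opp {..<v} L x) = 4"
    using line_card opp_in_L xy by blast
  moreover from this have "finite (opp {..<v} L x)"
    by (intro card_ge_0_finite) simp
  ultimately obtain a c where ac: "a \<in> opp {..<v} L x" "c \<in> opp {..<v} L x" "a \<noteq> c"
    using card_le_Suc0_iff_eq[of "opp {..<v} L x"] by auto
  have "\<exists>p q. a = \<tau> (?g z) p \<and> (?b z, p, q) \<in> set (flags F) \<and> \<kappa> a c = \<kappa> p q \<and> p < v"
    if z: "z < v" "a \<in> opp {..<v} L z" "c \<in> opp {..<v} L z" for z
  proof -
    obtain p q where pq: "p \<in> set (?b z)" "q \<in> set (?b z)" "a = \<tau> (?g z) p" "c = \<tau> (?g z) q"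
      using z(2,3) unfolding opp_block(1)[OF z(1)] by blast
    moreover have "p < v" "q < v"
      using pq block[OF opp_block(2)[OF \<open>z < v\<close>]] by auto
    moreover have "(?b z, p, q) \<in> set (flags F)"
      using pq opp_block(2)[OF \<open>z < v\<close>] ac by (auto simp: flags_iff)
    moreover have "\<kappa> a c = \<kappa> p q"
      using pq orbit_key_shift[OF t_dvd dvd_minus_mod] calculation by simp
    ultimately show ?thesis by blast
  qed
  from this[of x] this[of y] ac eq xy obtain p q p' q' where
    1: "a = \<tau> (?g x) p" "(?b x, p, q) \<in> set (flags F)" "\<kappa> a c = \<kappa> p q" "p < v" and
    2: "a = \<tau> (?g y) p'" "(?b y, p', q') \<in> set (flags F)" "\<kappa> a c = \<kappa> p' q'" "p' < v"
    by metis
  then have "?b x = ?b y \<and> p = p'"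
    using inj_onD[OF inj_flags, of "(?b x, p, q)" "(?b y, p', q')"] by auto
  moreover have "length (opp_blocks v A) = t"
    by (simp add: opp_blocks_def length_A)
  ultimately have "x mod t = y mod t"
    using distinct_opp_blocks t_pos by (simp add: nth_eq_iff_index_eq)
  moreover have "\<tau> (?g x) (x mod t) = \<tau> (?g y) (x mod t)"
    using 1 2 \<open>?b x = ?b y \<and> p = p'\<close> shift_eq_shift by metis
  moreover have "\<tau> (?g z) (z mod t) = z" if "z < v" for z
    using that by (simp add: shift_def)
  ultimately show "x = y"
    using xy by metis
qed

lemma opp_descends:
  assumes "x < v" "x \<noteq> 0"
  shows "\<exists>y\<in>opp {..<v} L x. y < x"
proof -
  let ?i = "x mod t"
  have i: "?i < t" using t_pos by simp
  obtain d where d: "d \<in> set (A ! ?i)" "v \<le> d + (if ?i = 0 then t else ?i)"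
    using descends[OF i] by blast
  \<comment> \<open>A nonzero multiple of \<open>t\<close> is at least \<open>t\<close>; any other
    \<open>x\<close> is at least its residue.\<close>
  have "(if ?i = 0 then t else ?i) \<le> x"
    using \<open>x \<noteq> 0\<close> by (auto intro: dvd_imp_le)
  with d have "v \<le> d + x" by linarith
  moreover have "d < v" using offset_less[OF i d(1)] by simp
  \<comment> \<open>Since \<open>v \<le> x + d < 2 * v\<close>, the sum wraps around exactly once,
    to \<open>x + d - v\<close>.\<close>
  ultimately have "\<tau> x d < x"
    using \<open>x < v\<close> by (simp add: shift_def le_mod_geq)
  then show ?thesis
    using d opp_eq[OF \<open>x < v\<close>] by auto
qed

sublocale opp_injective "{..<v}" L r
proof
  show "1 \<le> r" using r_pos by simp
qed (use line_subset line_card line_unique opp_in_L inj_opp opp_descends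
    in \<open>auto simp: v_def\<close>)

end

definition pentagonal_realizable :: "nat \<Rightarrow> bool" where
  "pentagonal_realizable r \<longleftrightarrow> (\<exists>(P :: nat set) L. pentagonal_geometry P L 4 r
    \<and> (\<nexists>l m. opposite_line_pair P L l m)
    \<and> Digraph_Component.connected (deficiency_graph P L)
    \<and> girth (deficiency_graph P L) \<ge> 5)"

lemma realizableI:
  assumes "valid_family r t A B S"
  shows "pentagonal_realizable r"
proof -
  interpret block_family r t A B S
    by unfold_locales (rule assms)
  show ?thesis
    using pentagonal no_opposite_line_pair connected girth_ge_5
    unfolding pentagonal_realizable_def by blast
qed

section \<open>The block families\<close>

text \<open>
  All base blocks were found by computer search for exact covers of the orbits of pairs.
\<close>

lemma family_29: "valid_family 29 2
  [[1,4,88,91], [1,16,76,91]]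
  [[0,6,57,70], [0,7,55,59], [0,9,18,54], [0,10,26,50], [0,11,34,67], [0,12,25,72],
   [0,14,43,53], [0,19,37,48], [0,21,49,71], [0,23,30,61], [0,35,41,65], [1,9,21,35]]
  [(0,27)]"
  \<comment> \<open>Evaluation is by rewriting with code equations and so stays inside the
    kernel.\<close>
  by code_simp

lemma family_33: "valid_family 33 2
  [[1,11,73,103], [1,31,93,103]]
  [[0,3,16,70], [0,4,68,82], [0,5,43,46], [0,6,51,67], [0,7,24,89], [0,8,25,85], [0,9,66,95],
   [0,13,59,84], [0,15,39,44], [0,18,41,49], [0,21,35,56], [0,27,53,76], [0,57,93,97],
   [1,7,57,77]]
  [(0,19)]"
  by code_simp

lemma family_37: "valid_family 37 2
  [[1,40,76,115], [1,34,82,115]]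
  [[0,3,97,107], [0,4,65,96], [0,6,53,109], [0,7,56,71], [0,8,95,99], [0,9,66,89], [0,10,21,32],
   [0,12,25,31], [0,14,52,82], [0,16,45,73], [0,17,37,55], [0,18,62,88], [0,27,42,111],
   [0,43,51,113], [0,49,79,93], [1,17,41,91]]
  [(0,5)]"
  by code_simp

lemma family_40: "valid_family 40 5
  [[1,43,69,124], [1,61,81,124], [1,44,64,124], [1,66,82,124], [1,56,59,124]]
  [[0,4,11,75], [0,5,18,22], [0,6,85,115], [0,7,38,91], [0,8,81,100], [0,9,28,57], [0,12,15,36],
   [0,14,53,111], [0,19,47,117], [0,20,87,98], [0,23,45,79], [0,24,60,99], [0,26,112,119],
   [0,27,64,113], [0,29,97,116], [0,31,56,74], [0,32,37,83], [0,35,84,121], [0,41,48,76],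
   [0,51,59,77], [0,52,108,114], [0,63,66,71], [0,72,88,93], [0,73,94,107], [0,92,96,102],
   [0,101,104,118], [1,11,41,64], [1,12,38,93], [1,13,77,109], [1,14,48,99], [1,16,67,103],
   [1,17,59,112], [1,22,74,97], [1,23,37,84], [1,28,76,108], [1,32,47,72], [1,34,56,113],
   [1,49,57,92], [1,79,114,117], [2,8,24,108], [2,14,94,103], [2,19,43,73], [2,68,78,118],
   [3,14,18,108], [4,9,104,114]]
  []"
  by code_simp

lemma family_45: "valid_family 45 2
  [[1,31,35,139], [1,105,109,139]]
  [[0,3,84,129], [0,5,66,92], [0,6,15,22], [0,7,86,98], [0,8,75,81], [0,10,28,88], [0,11,50,91],
   [0,13,23,51], [0,14,107,131], [0,19,76,116], [0,20,58,105], [0,21,97,109], [0,25,46,111],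
   [0,27,68,123], [0,29,77,127], [0,33,95,115], [0,37,121,137], [0,39,44,113], [0,57,103,125],
   [0,63,71,89]]
  [(0,17)]"
  by code_simp

lemma family_49: "valid_family 49 2
  [[1,14,138,151], [1,68,84,151]]
  [[0,3,37,130], [0,4,122,127], [0,6,93,107], [0,7,50,103], [0,8,88,114], [0,9,36,135],
   [0,10,43,55], [0,11,49,140], [0,16,86,128], [0,17,74,92], [0,19,91,96], [0,20,41,131],
   [0,27,62,119], [0,29,68,100], [0,31,104,143], [0,35,58,121], [0,44,115,133], [0,47,51,54],
   [0,73,97,105], [1,7,107,117], [1,21,65,95], [1,23,71,125]]
  [(0,65)]"
  by code_simp

text \<open>Here \<open>v = 161 = 7 * 23\<close> has no divisor between 1 and 7, so seven classes of
  points are used, each with its own opposite block.\<close>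

lemma family_52: "valid_family 52 7
  [[1,117,130,160], [1,141,145,160], [1,20,52,160], [1,94,141,160], [1,20,31,160],
   [1,44,109,160], [1,16,67,160]]
  [[0,3,6,34], [0,4,94,143], [0,5,27,77], [0,7,32,106], [0,8,67,105], [0,9,86,125],
   [0,10,19,113], [0,11,51,69], [0,12,39,138], [0,13,68,126], [0,14,148,158], [0,16,61,81],
   [0,17,24,52], [0,18,97,121], [0,20,33,98], [0,21,59,93], [0,22,85,124], [0,23,36,71],
   [0,26,62,133], [0,29,78,156], [0,30,44,76], [0,31,58,119], [0,37,127,149], [0,40,87,101],
   [0,41,70,145], [0,43,49,137], [0,45,122,152], [0,46,109,153], [0,47,80,120], [0,50,55,115],
   [0,53,102,136], [0,57,141,157], [0,60,95,108], [0,74,135,151], [0,79,107,114],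
   [0,82,110,128], [0,92,104,139], [1,4,153,159], [1,5,58,75], [1,8,19,45], [1,9,150,158],
   [1,10,93,102], [1,15,124,129], [1,16,24,39], [1,18,26,139], [1,20,47,81], [1,25,82,90],
   [1,27,30,121], [1,29,62,120], [1,31,107,137], [1,32,86,108], [1,37,87,123], [1,41,55,106],
   [1,44,73,116], [1,46,51,157], [1,53,69,131], [1,61,76,151], [1,65,80,144], [1,67,94,135],
   [1,74,100,136], [1,83,125,132], [1,96,152,156], [1,109,118,138], [2,5,76,94], [2,12,90,115],
   [2,13,39,46], [2,26,111,150], [2,27,61,101], [2,33,58,121], [2,40,104,157], [2,45,62,131],
   [2,59,83,124], [2,66,82,132], [2,68,89,152], [2,73,96,125], [2,116,130,153], [3,13,59,101],
   [3,32,73,152], [3,41,60,132], [3,48,153,158], [3,62,83,160], [4,19,26,68], [4,32,74,117],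
   [4,40,54,109]]
  []"
  by code_simp

lemma family_53: "valid_family 53 2
  [[1,85,155,163], [1,9,79,163]]
  [[0,3,26,74], [0,4,42,56], [0,5,21,109], [0,6,68,151], [0,7,76,115], [0,9,16,41],
   [0,11,33,54], [0,12,58,101], [0,13,44,125], [0,15,29,131], [0,17,113,130], [0,18,79,91],
   [0,19,23,63], [0,20,75,139], [0,22,114,149], [0,24,111,161], [0,27,65,99], [0,28,60,105],
   [0,30,67,128], [0,31,57,124], [0,49,69,123], [0,53,100,159], [0,107,135,153], [1,7,43,141]]
  [(0,129)]"
  by code_simp

text \<open>For this \<open>r\<close> and for 80, 100, 120, 160 and 180, the descents are by 5, 1,
  2, 2 and 3 in the classes 0 to 4; they are the last entries of the opposite lists, read as
  negative differences. In all other families every opposite list contains 1 and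
  \<open>v - 1\<close>, and the deficiency graph contains the cycle through all residues in their
  natural order.\<close>

lemma family_60: "valid_family 60 5
  [[1,2,5,180], [2,3,16,184], [7,136,169,183], [49,50,135,183], [55,130,178,182]]
  [[0,8,48,68], [0,11,26,86], [0,12,66,91], [0,13,36,183], [0,14,75,104], [0,15,65,84],
   [0,16,54,137], [0,18,107,142], [0,20,116,134], [0,21,58,162], [0,22,40,121], [0,23,136,155],
   [0,24,90,152], [0,25,113,123], [0,27,67,132], [0,28,56,147], [0,31,39,184], [0,32,42,146],
   [0,33,55,100], [0,34,73,112], [0,35,105,164], [0,37,83,126], [0,38,93,128], [0,41,94,157],
   [0,43,74,161], [0,44,97,103], [0,46,89,101], [0,47,49,158], [0,51,60,139], [0,52,108,179],
   [0,57,148,173], [0,61,122,144], [0,63,72,109], [0,64,111,177], [0,71,141,172],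
   [0,76,133,178], [0,77,127,153], [0,78,151,156], [0,82,87,174], [0,92,131,143],
   [0,99,149,159], [0,102,117,169], [0,106,154,168], [1,7,34,156], [1,8,27,74], [1,11,88,151],
   [1,12,33,112], [1,14,86,106], [1,18,133,149], [1,22,104,183], [1,23,124,159], [1,28,121,177],
   [1,29,144,172], [1,41,83,167], [1,42,119,152], [1,47,96,164], [1,48,77,109], [1,51,168,179],
   [1,79,178,184], [1,98,128,162], [1,157,169,173], [2,13,164,167], [2,19,57,183],
   [2,27,72,169], [2,32,73,127], [2,114,143,179], [3,8,83,124], [3,29,114,123], [3,54,84,99],
   [3,144,164,169]]
  []"
  by code_simp

lemma family_61: "valid_family 61 2
  [[1,119,123,187], [1,65,69,187]]
  [[0,3,9,173], [0,5,161,171], [0,6,32,180], [0,7,28,157], [0,10,81,179], [0,11,55,88],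
   [0,12,89,115], [0,13,36,109], [0,15,45,90], [0,16,60,142], [0,17,74,127], [0,18,75,164],
   [0,19,33,149], [0,20,83,137], [0,21,159,166], [0,23,58,150], [0,25,30,116], [0,27,52,108],
   [0,29,85,133], [0,31,105,154], [0,35,78,147], [0,37,50,104], [0,39,76,125], [0,41,141,177],
   [0,47,87,140], [0,51,67,79], [0,59,93,101], [1,21,81,127]]
  [(0,91)]"
  by code_simp

lemma family_65: "valid_family 65 2
  [[1,66,134,199], [1,90,110,199]]
  [[0,3,59,185], [0,4,13,94], [0,5,73,102], [0,6,29,178], [0,7,49,129], [0,8,78,92],
   [0,10,165,197], [0,11,156,176], [0,12,81,127], [0,15,85,140], [0,16,157,167], [0,17,34,74],
   [0,18,45,168], [0,19,71,96], [0,21,138,177], [0,25,72,120], [0,26,125,162], [0,30,76,112],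
   [0,31,61,114], [0,33,139,146], [0,37,113,144], [0,41,57,63], [0,42,179,191], [0,43,142,189],
   [0,52,159,173], [0,53,79,161], [0,97,131,181], [1,5,63,177], [1,9,49,137], [1,37,97,135]]
  [(0,195)]"
  by code_simp

lemma family_69: "valid_family 69 2
  [[1,90,122,211], [1,80,132,211]]
  [[0,3,127,159], [0,4,146,157], [0,5,12,68], [0,6,36,145], [0,7,44,115], [0,8,24,112],
   [0,9,105,179], [0,10,95,117], [0,13,114,162], [0,14,53,166], [0,15,31,80], [0,17,38,193],
   [0,18,96,119], [0,19,47,118], [0,20,158,207], [0,21,161,165], [0,22,173,199], [0,25,28,178],
   [0,26,69,93], [0,27,42,97], [0,33,45,83], [0,35,129,172], [0,37,64,167], [0,41,87,110],
   [0,51,61,92], [0,52,125,136], [0,57,77,86], [0,58,130,195], [1,7,61,127], [1,9,123,137],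
   [1,19,59,169], [1,31,65,165]]
  [(0,29)]"
  by code_simp

lemma family_77: "valid_family 77 2
  [[1,141,219,235], [1,17,95,235]]
  [[0,3,42,65], [0,4,41,169], [0,5,45,208], [0,6,49,106], [0,7,27,70], [0,8,52,229],
   [0,9,126,210], [0,10,30,174], [0,11,25,116], [0,12,68,107], [0,13,181,213], [0,14,54,202],
   [0,15,80,137], [0,17,66,90], [0,19,83,176], [0,21,124,223], [0,22,125,150], [0,29,55,85],
   [0,31,64,198], [0,32,82,149], [0,36,111,159], [0,46,151,178], [0,47,71,121], [0,51,61,127],
   [0,53,98,185], [0,59,147,205], [0,63,115,175], [0,74,183,227], [0,76,167,189],
   [0,77,161,233], [0,81,122,215], [0,97,135,217], [0,101,155,201], [0,129,157,199],
   [0,139,225,231], [1,5,131,229]]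
  [(0,89)]"
  by code_simp

lemma family_80: "valid_family 80 5
  [[1,2,5,240], [2,3,66,244], [126,172,179,243], [90,119,155,243], [73,95,150,242]]
  [[0,8,120,229], [0,9,158,202], [0,11,114,234], [0,12,65,152], [0,13,62,190], [0,14,107,194],
   [0,15,35,85], [0,16,163,168], [0,17,21,236], [0,18,34,193], [0,19,36,76], [0,22,69,182],
   [0,23,90,164], [0,24,99,233], [0,25,162,170], [0,26,113,185], [0,27,59,143], [0,28,45,206],
   [0,29,48,98], [0,30,124,138], [0,31,84,110], [0,32,111,129], [0,33,53,81], [0,37,96,106],
   [0,38,139,144], [0,39,43,119], [0,40,82,217], [0,41,52,183], [0,44,105,208], [0,46,83,157],
   [0,47,58,232], [0,49,134,146], [0,51,92,167], [0,54,122,176], [0,56,169,201], [0,57,148,214],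
   [0,61,104,150], [0,63,179,213], [0,64,72,238], [0,66,78,196], [0,71,93,123], [0,73,118,209],
   [0,77,115,227], [0,79,80,216], [0,88,91,231], [0,89,147,197], [0,97,211,239],
   [0,101,116,223], [0,102,121,126], [0,127,203,221], [0,131,154,243], [0,132,153,172],
   [0,141,218,226], [0,142,188,222], [0,149,151,186], [0,159,187,212], [0,171,191,204],
   [0,189,198,224], [1,7,48,91], [1,8,22,181], [1,9,164,223], [1,17,126,197], [1,18,57,74],
   [1,26,163,204], [1,28,89,176], [1,32,133,196], [1,33,84,199], [1,37,47,76], [1,39,182,191],
   [1,43,64,188], [1,46,147,202], [1,49,111,168], [1,52,97,219], [1,59,92,166], [1,61,129,178],
   [1,62,96,174], [1,63,194,233], [1,83,107,232], [1,119,169,213], [1,127,134,208],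
   [1,142,144,173], [2,3,7,113], [2,8,14,17], [2,18,28,209], [2,22,163,178], [2,29,44,229],
   [2,32,88,234], [2,37,109,119], [2,39,59,157], [2,53,64,147], [2,63,148,188], [2,68,123,177],
   [2,69,94,117], [3,28,63,143], [4,34,139,179]]
  []"
  by code_simp

lemma family_81: "valid_family 81 2
  [[1,97,209,247], [1,39,151,247]]
  [[0,3,25,232], [0,4,87,245], [0,5,26,149], [0,6,144,206], [0,7,134,213], [0,8,78,88],
   [0,9,82,135], [0,11,58,223], [0,12,85,145], [0,13,94,211], [0,14,90,212], [0,15,35,194],
   [0,17,191,219], [0,18,64,189], [0,20,44,128], [0,21,65,205], [0,22,217,221], [0,23,31,92],
   [0,27,99,105], [0,28,103,157], [0,29,163,177], [0,30,101,169], [0,32,109,118],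
   [0,33,197,229], [0,34,106,180], [0,37,67,153], [0,39,115,141], [0,43,66,161], [0,45,111,127],
   [0,47,52,237], [0,49,116,235], [0,51,131,143], [0,55,215,233], [0,56,113,137], [0,59,93,148],
   [0,60,151,207], [0,61,155,203], [0,63,173,183]]
  [(0,231)]"
  by code_simp

lemma family_85: "valid_family 85 2
  [[1,63,149,259], [1,111,197,259]]
  [[0,3,208,221], [0,4,69,232], [0,5,104,197], [0,6,35,257], [0,7,40,249], [0,8,31,58],
   [0,9,145,166], [0,10,25,30], [0,11,85,192], [0,12,92,188], [0,14,120,165], [0,16,37,160],
   [0,17,118,219], [0,18,152,205], [0,19,48,146], [0,22,105,225], [0,24,193,237],
   [0,26,102,217], [0,27,129,155], [0,33,41,73], [0,34,157,235], [0,36,131,207], [0,38,179,216],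
   [0,39,49,190], [0,42,88,177], [0,43,125,186], [0,47,66,173], [0,51,139,167], [0,54,132,243],
   [0,56,113,143], [0,59,75,124], [0,60,127,245], [0,61,138,215], [0,71,121,175],
   [0,81,147,247], [0,90,181,253], [1,5,181,241], [1,7,115,171], [1,13,225,239], [1,47,139,209]]
  [(0,99)]"
  by code_simp

lemma family_93: "valid_family 93 2
  [[1,63,253,283], [1,31,221,283]]
  [[0,3,95,162], [0,4,47,65], [0,5,177,216], [0,6,45,240], [0,7,105,143], [0,8,258,268],
   [0,9,33,237], [0,11,87,146], [0,12,40,224], [0,13,130,189], [0,14,185,202], [0,15,83,86],
   [0,17,119,266], [0,19,101,182], [0,20,156,246], [0,21,66,236], [0,22,153,161],
   [0,23,145,197], [0,25,29,265], [0,27,116,251], [0,31,53,241], [0,36,165,228], [0,37,207,214],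
   [0,41,111,134], [0,42,88,159], [0,49,133,206], [0,51,126,249], [0,52,164,279],
   [0,54,229,269], [0,55,109,160], [0,57,118,275], [0,67,103,200], [0,74,178,255],
   [0,75,147,205], [0,76,173,186], [0,79,144,257], [0,80,243,263], [0,81,201,247],
   [0,85,91,176], [0,99,141,152], [0,155,169,259], [1,11,157,207], [1,13,153,269],
   [1,27,151,185]]
  [(0,93)]"
  by code_simp

lemma family_97: "valid_family 97 2
  [[1,19,231,295], [1,65,277,295]]
  [[0,3,164,224], [0,4,237,250], [0,5,11,155], [0,6,83,175], [0,7,199,202], [0,8,73,222],
   [0,9,24,81], [0,10,225,248], [0,12,141,261], [0,13,89,118], [0,14,154,268], [0,15,34,145],
   [0,16,210,279], [0,17,29,197], [0,21,109,152], [0,22,63,121], [0,23,67,226], [0,25,150,185],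
   [0,26,62,221], [0,27,51,180], [0,30,200,243], [0,31,208,240], [0,33,110,205], [0,37,107,216],
   [0,38,206,245], [0,40,138,241], [0,44,223,227], [0,45,112,289], [0,47,134,247],
   [0,49,149,291], [0,52,131,188], [0,53,91,176], [0,54,130,235], [0,55,71,157], [0,59,217,257],
   [0,61,92,196], [0,68,153,190], [0,78,203,271], [0,97,124,287], [0,115,151,285],
   [0,123,133,255], [0,139,189,251], [1,9,187,215], [1,15,61,95], [1,23,49,79], [1,33,141,255]]
  [(0,275)]"
  by code_simp

lemma family_100: "valid_family 100 5
  [[1,2,5,300], [2,3,21,304], [7,241,284,303], [64,65,240,303], [70,235,298,302]]
  [[0,8,143,270], [0,11,56,212], [0,12,169,189], [0,13,67,161], [0,14,60,134], [0,15,124,248],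
   [0,16,48,141], [0,17,108,227], [0,18,59,238], [0,19,153,186], [0,20,127,135], [0,21,138,188],
   [0,23,25,230], [0,24,116,196], [0,26,85,197], [0,27,192,263], [0,28,84,278], [0,29,265,299],
   [0,30,83,244], [0,31,66,77], [0,32,72,164], [0,33,132,137], [0,36,142,144], [0,37,147,254],
   [0,38,45,232], [0,39,118,199], [0,41,130,195], [0,42,201,255], [0,44,80,219], [0,46,95,267],
   [0,47,149,162], [0,49,148,160], [0,51,193,266], [0,52,119,122], [0,54,156,180],
   [0,55,184,213], [0,57,202,291], [0,58,117,207], [0,61,157,185], [0,62,237,289],
   [0,63,121,274], [0,64,86,215], [0,68,200,287], [0,70,222,296], [0,71,166,279],
   [0,73,155,288], [0,76,113,234], [0,78,165,258], [0,79,174,228], [0,81,88,96], [0,82,252,261],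
   [0,89,103,208], [0,91,101,206], [0,94,203,209], [0,97,111,198], [0,99,183,204],
   [0,102,257,282], [0,104,163,273], [0,106,217,229], [0,114,239,284], [0,123,126,191],
   [0,128,242,271], [0,131,171,224], [0,136,167,211], [0,146,168,268], [0,159,236,241],
   [0,177,276,294], [0,182,231,264], [0,221,247,283], [0,249,272,304], [0,253,262,292],
   [1,7,128,133], [1,9,71,278], [1,13,206,294], [1,14,48,279], [1,17,136,199], [1,18,92,246],
   [1,21,164,267], [1,24,219,272], [1,26,203,252], [1,28,43,182], [1,31,83,161], [1,37,99,237],
   [1,39,253,264], [1,42,151,223], [1,44,166,221], [1,49,57,79], [1,51,268,299], [1,52,58,189],
   [1,59,102,149], [1,62,117,198], [1,69,183,196], [1,77,137,289], [1,82,103,138],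
   [1,84,192,234], [1,87,174,193], [1,93,188,258], [1,98,177,194], [1,104,132,169],
   [1,108,122,148], [1,119,121,282], [1,142,173,288], [1,153,254,287], [1,167,242,283],
   [1,259,269,274], [2,12,223,249], [2,13,99,242], [2,17,63,209], [2,18,52,124], [2,22,122,283],
   [2,29,133,222], [2,37,224,262], [2,53,129,198], [2,68,98,143], [2,149,278,303],
   [2,174,234,259], [3,13,64,269], [3,19,63,83], [3,49,188,304], [3,69,158,299]]
  []"
  by code_simp

lemma family_101: "valid_family 101 2
  [[1,77,299,307], [1,9,231,307]]
  [[0,3,42,150], [0,4,55,241], [0,5,104,289], [0,6,13,117], [0,9,234,291], [0,11,201,221],
   [0,12,85,279], [0,14,136,273], [0,15,100,197], [0,16,149,290], [0,17,59,216], [0,19,199,202],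
   [0,20,141,155], [0,21,36,81], [0,22,112,160], [0,23,144,179], [0,24,61,268], [0,25,53,98],
   [0,26,65,88], [0,27,79,239], [0,28,123,206], [0,29,146,249], [0,30,71,214], [0,31,67,156],
   [0,32,198,256], [0,33,114,242], [0,38,129,177], [0,43,153,207], [0,44,126,233],
   [0,46,93,217], [0,49,60,252], [0,50,120,295], [0,54,134,247], [0,63,147,190], [0,68,140,283],
   [0,69,163,231], [0,87,253,257], [0,89,205,261], [0,96,211,255], [0,119,169,176],
   [0,127,145,303], [0,131,213,271], [0,157,203,277], [0,173,243,281], [0,195,275,287],
   [1,7,23,113], [1,31,209,275], [1,33,73,135]]
  [(0,229)]"
  by code_simp

lemma family_108: "valid_family 108 7
  [[1,46,52,328], [1,5,276,328], [1,133,196,328], [1,192,277,328], [1,53,283,328],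
   [1,133,196,328], [1,137,324,328]]
  [[0,3,299,319], [0,4,16,81], [0,5,27,158], [0,7,185,202], [0,8,91,130], [0,9,84,124],
   [0,10,163,318], [0,11,188,307], [0,12,26,211], [0,13,216,253], [0,14,193,197], [0,15,61,141],
   [0,17,112,146], [0,18,125,208], [0,19,92,229], [0,20,70,101], [0,21,138,261], [0,22,282,303],
   [0,23,37,165], [0,24,44,218], [0,25,75,96], [0,28,160,248], [0,29,170,255], [0,30,149,284],
   [0,32,235,317], [0,33,43,295], [0,35,153,262], [0,36,73,192], [0,38,123,164], [0,41,62,215],
   [0,42,184,236], [0,48,57,79], [0,49,180,247], [0,50,263,266], [0,54,288,297], [0,55,103,270],
   [0,56,167,269], [0,58,171,176], [0,59,177,186], [0,60,134,147], [0,64,107,296],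
   [0,65,90,100], [0,66,121,157], [0,67,93,305], [0,68,145,274], [0,69,191,258], [0,71,285,309],
   [0,72,110,133], [0,74,162,189], [0,76,199,224], [0,77,205,250], [0,78,172,203],
   [0,80,143,226], [0,82,271,312], [0,83,88,324], [0,85,116,154], [0,86,97,230], [0,87,166,222],
   [0,89,94,155], [0,95,115,264], [0,98,225,249], [0,102,233,310], [0,104,108,161],
   [0,106,275,325], [0,109,148,210], [0,114,265,281], [0,120,169,219], [0,122,187,311],
   [0,129,135,241], [0,137,144,206], [0,139,243,251], [0,150,283,292], [0,152,237,300],
   [0,156,212,293], [0,159,207,256], [0,174,232,239], [0,190,201,321], [0,200,209,320],
   [0,221,286,289], [0,223,257,314], [0,278,290,313], [1,4,122,216], [1,9,114,178],
   [1,11,54,289], [1,13,33,64], [1,15,176,195], [1,16,166,179], [1,17,59,99], [1,18,75,275],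
   [1,19,268,284], [1,22,58,318], [1,24,34,53], [1,26,128,151], [1,27,206,228], [1,29,113,188],
   [1,30,69,244], [1,31,45,129], [1,36,115,260], [1,39,174,199], [1,40,65,102], [1,41,148,288],
   [1,48,87,130], [1,55,125,307], [1,57,167,285], [1,60,184,208], [1,61,79,137], [1,62,192,249],
   [1,66,146,207], [1,67,107,292], [1,72,89,158], [1,73,101,120], [1,74,93,313], [1,81,164,251],
   [1,82,219,298], [1,86,152,235], [1,88,117,303], [1,94,230,319], [1,97,153,258],
   [1,103,187,202], [1,104,171,270], [1,108,209,312], [1,109,139,304], [1,110,255,262],
   [1,116,213,237], [1,118,150,263], [1,121,134,324], [1,144,236,240], [1,149,159,305],
   [1,165,243,254], [1,172,194,310], [1,173,180,271], [1,177,205,247], [1,186,222,296],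
   [1,193,241,286], [1,200,234,300], [1,221,226,327], [2,5,80,258], [2,9,179,240],
   [2,10,118,124], [2,17,230,243], [2,20,94,110], [2,24,32,298], [2,31,265,292], [2,33,76,290],
   [2,34,45,75], [2,48,206,250], [2,51,163,304], [2,55,104,184], [2,59,244,299], [2,61,167,227],
   [2,62,97,156], [2,73,111,180], [2,86,186,318], [2,89,125,297], [2,101,174,271],
   [2,109,181,188], [2,122,228,284], [2,129,160,285], [2,132,150,278], [2,138,164,307],
   [2,159,223,269], [2,166,220,279], [2,173,192,314], [2,201,241,293], [2,236,283,286],
   [3,18,179,193], [3,38,96,271], [3,39,81,221], [3,40,67,157], [3,52,103,250], [3,53,80,262],
   [3,59,151,227], [3,74,158,186], [4,12,200,215], [4,20,278,312], [4,27,55,123],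
   [4,39,109,258], [4,48,90,102], [4,89,131,159], [4,160,222,327], [4,209,293,307],
   [5,34,173,285]]
  []"
  by code_simp

lemma family_109: "valid_family 109 2
  [[1,203,253,331], [1,79,129,331]]
  [[0,3,17,124], [0,4,77,142], [0,5,216,283], [0,6,107,304], [0,7,111,264], [0,8,99,300],
   [0,9,214,308], [0,10,22,205], [0,11,153,323], [0,13,288,306], [0,14,170,189], [0,15,42,227],
   [0,16,259,277], [0,20,61,242], [0,21,96,235], [0,23,30,83], [0,25,161,192], [0,27,173,240],
   [0,29,74,221], [0,31,71,164], [0,35,187,226], [0,36,218,281], [0,37,212,299], [0,38,160,327],
   [0,43,62,206], [0,45,48,143], [0,46,155,279], [0,47,148,250], [0,51,134,246], [0,52,275,307],
   [0,54,271,295], [0,55,72,180], [0,56,125,159], [0,58,171,309], [0,59,209,268],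
   [0,60,145,158], [0,65,196,285], [0,66,181,244], [0,70,146,263], [0,79,100,297],
   [0,81,97,200], [0,84,247,303], [0,93,104,237], [0,105,149,177], [0,191,291,317],
   [1,5,47,271], [1,7,161,243], [1,9,165,257], [1,11,117,185], [1,13,211,259], [1,23,59,111],
   [1,31,95,133]]
  [(0,49)]"
  by code_simp

lemma family_117: "valid_family 117 2
  [[1,93,317,355], [1,39,263,355]]
  [[0,3,32,188], [0,4,230,280], [0,5,124,340], [0,6,141,217], [0,7,339,346], [0,8,242,323],
   [0,9,267,279], [0,11,68,123], [0,12,118,304], [0,13,202,245], [0,14,110,134], [0,15,29,82],
   [0,18,89,249], [0,19,42,221], [0,20,95,139], [0,22,151,160], [0,23,108,321], [0,25,73,284],
   [0,26,65,85], [0,27,173,247], [0,28,131,180], [0,30,61,192], [0,33,58,285], [0,34,101,239],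
   [0,35,98,257], [0,36,99,256], [0,37,84,174], [0,41,137,319], [0,44,149,165], [0,45,163,253],
   [0,46,155,207], [0,47,215,241], [0,48,281,343], [0,49,83,252], [0,51,57,305], [0,53,117,144],
   [0,54,223,268], [0,56,158,228], [0,60,193,243], [0,62,175,270], [0,66,177,341],
   [0,69,190,297], [0,74,269,337], [0,77,150,351], [0,78,259,287], [0,79,189,244],
   [0,87,229,240], [0,91,157,277], [0,115,291,313], [0,125,197,251], [0,127,210,353],
   [0,185,255,335], [1,5,315,325], [1,9,123,153], [1,19,107,191], [1,57,157,297]]
  [(0,325)]"
  by code_simp

lemma family_120: "valid_family 120 5
  [[1,2,5,360], [2,3,311,364], [54,187,346,363], [19,40,325,363], [45,178,320,362]]
  [[0,8,99,119], [0,9,169,254], [0,11,191,301], [0,12,93,124], [0,13,337,351], [0,14,160,338],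
   [0,15,97,201], [0,16,239,273], [0,17,150,266], [0,18,62,154], [0,19,32,263], [0,20,165,320],
   [0,21,130,188], [0,22,70,203], [0,23,199,281], [0,24,175,217], [0,25,115,196],
   [0,26,134,209], [0,27,44,335], [0,28,117,274], [0,29,85,241], [0,31,293,363], [0,33,234,242],
   [0,34,95,221], [0,35,103,286], [0,36,114,336], [0,37,75,347], [0,38,125,282], [0,39,297,321],
   [0,40,112,323], [0,41,63,67], [0,43,264,276], [0,46,86,310], [0,47,291,308], [0,48,173,267],
   [0,49,108,288], [0,50,193,230], [0,51,265,324], [0,52,249,259], [0,53,120,231],
   [0,54,152,314], [0,60,306,359], [0,61,128,158], [0,64,268,316], [0,66,284,313],
   [0,69,113,121], [0,71,87,225], [0,73,296,307], [0,76,213,364], [0,77,123,339],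
   [0,78,110,202], [0,79,342,344], [0,80,233,287], [0,83,198,331], [0,84,98,172], [0,88,91,277],
   [0,89,104,206], [0,94,177,226], [0,96,105,302], [0,102,229,353], [0,106,244,318],
   [0,107,159,183], [0,109,132,243], [0,118,168,261], [0,122,148,208], [0,127,164,228],
   [0,129,138,237], [0,131,218,341], [0,136,194,332], [0,137,179,181], [0,139,142,248],
   [0,144,162,271], [0,146,236,322], [0,147,192,292], [0,149,262,326], [0,161,174,224],
   [0,163,170,357], [0,166,257,269], [0,167,289,319], [0,176,238,294], [0,182,311,343],
   [0,184,216,253], [0,204,223,352], [0,212,303,346], [0,222,258,354], [0,247,329,334],
   [0,252,279,349], [1,6,44,174], [1,7,127,266], [1,8,298,321], [1,9,37,163], [1,11,313,337],
   [1,13,42,329], [1,16,241,297], [1,19,194,283], [1,21,151,308], [1,24,218,353], [1,26,97,271],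
   [1,29,102,198], [1,31,82,231], [1,32,209,344], [1,34,159,253], [1,36,307,316], [1,47,69,269],
   [1,48,164,222], [1,56,149,261], [1,58,221,319], [1,61,172,251], [1,62,292,296],
   [1,67,214,286], [1,73,178,212], [1,74,299,359], [1,77,78,244], [1,83,202,338],
   [1,89,128,259], [1,93,103,268], [1,113,304,339], [1,123,204,267], [1,124,238,252],
   [1,129,162,279], [1,137,152,171], [1,142,148,173], [1,153,208,229], [1,157,167,247],
   [1,193,278,349], [1,199,242,309], [1,228,277,348], [2,7,72,288], [2,9,64,237], [2,13,77,143],
   [2,18,188,329], [2,22,107,272], [2,27,62,242], [2,32,142,192], [2,34,157,327], [2,49,53,319],
   [2,63,249,328], [2,79,208,358], [2,118,184,299], [2,153,198,204], [2,168,258,274],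
   [2,203,214,298], [3,8,163,228], [3,18,38,64], [4,29,69,214]]
  []"
  by code_simp

lemma family_125: "valid_family 125 2
  [[1,101,175,379], [1,205,279,379]]
  [[0,3,120,159], [0,4,126,223], [0,5,40,251], [0,6,52,110], [0,7,284,354], [0,8,116,274],
   [0,9,118,267], [0,10,92,348], [0,11,27,261], [0,12,48,125], [0,13,285,308], [0,14,169,321],
   [0,15,18,214], [0,16,187,240], [0,17,239,343], [0,19,60,129], [0,20,245,333], [0,21,186,209],
   [0,22,164,309], [0,24,65,268], [0,25,35,337], [0,28,172,229], [0,29,188,371], [0,30,147,230],
   [0,31,38,170], [0,34,88,168], [0,37,107,232], [0,43,64,259], [0,44,235,325], [0,45,247,286],
   [0,47,51,296], [0,49,66,233], [0,50,213,355], [0,53,133,179], [0,55,152,282], [0,56,207,273],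
   [0,59,299,312], [0,61,90,252], [0,62,227,365], [0,63,87,123], [0,67,277,304], [0,71,301,335],
   [0,73,121,178], [0,75,199,361], [0,78,157,369], [0,81,182,375], [0,83,146,319],
   [0,86,197,289], [0,89,161,226], [0,91,109,160], [0,93,99,119], [0,95,137,249],
   [0,105,138,253], [0,205,257,269], [0,231,293,349], [0,237,265,295], [1,9,115,129],
   [1,23,99,195], [1,33,83,215], [1,41,85,221]]
  [(0,141)]"
  by code_simp

lemma family_133: "valid_family 133 2
  [[1,78,326,403], [1,38,366,403]]
  [[0,4,161,390], [0,5,168,369], [0,6,187,260], [0,7,99,397], [0,8,221,263], [0,9,54,384],
   [0,10,57,73], [0,11,59,192], [0,12,143,244], [0,13,121,170], [0,15,136,275], [0,16,102,193],
   [0,17,276,356], [0,19,259,345], [0,21,110,361], [0,22,204,250], [0,23,90,120],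
   [0,24,219,328], [0,25,28,88], [0,26,53,141], [0,31,285,379], [0,32,75,185], [0,33,233,264],
   [0,34,158,225], [0,35,116,299], [0,36,94,132], [0,40,89,351], [0,41,52,216], [0,42,111,291],
   [0,44,210,357], [0,45,199,270], [0,50,287,399], [0,51,165,198], [0,55,112,281],
   [0,56,242,334], [0,61,129,289], [0,62,189,258], [0,64,261,343], [0,66,159,375],
   [0,68,163,298], [0,71,84,293], [0,72,214,296], [0,81,98,301], [0,83,119,149], [0,85,97,253],
   [0,87,137,235], [0,101,184,319], [0,103,130,297], [0,104,217,227], [0,105,277,339],
   [0,107,122,353], [0,109,245,305], [0,114,239,329], [0,117,138,256], [0,133,151,267],
   [0,152,363,395], [0,155,178,385], [0,171,273,317], [1,5,105,125], [1,7,279,353], [1,9,55,81],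
   [1,23,275,309], [1,25,239,267], [1,71,199,283]]
  [(0,205)]"
  by code_simp

lemma family_140: "valid_family 140 5
  [[1,223,317,424], [1,243,256,424], [1,108,169,424], [1,202,376,424], [1,49,182,424]]
  [[0,3,34,392], [0,4,196,291], [0,5,112,381], [0,6,76,82], [0,7,301,310], [0,8,18,299],
   [0,9,146,254], [0,10,43,153], [0,11,70,330], [0,12,113,193], [0,13,344,362], [0,14,44,422],
   [0,15,99,228], [0,16,27,379], [0,17,141,285], [0,19,118,255], [0,20,256,329], [0,21,85,212],
   [0,22,80,121], [0,23,50,249], [0,24,230,354], [0,25,262,421], [0,26,56,402], [0,28,209,371],
   [0,29,251,272], [0,30,111,387], [0,31,211,311], [0,32,206,305], [0,35,77,92], [0,36,132,353],
   [0,37,282,303], [0,38,93,406], [0,39,218,296], [0,40,283,414], [0,45,114,253],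
   [0,46,139,171], [0,47,89,267], [0,49,200,373], [0,51,356,388], [0,52,180,270], [0,53,87,383],
   [0,54,295,363], [0,55,271,377], [0,58,324,333], [0,59,323,334], [0,60,162,412],
   [0,62,187,338], [0,63,109,215], [0,64,238,250], [0,65,161,232], [0,66,242,397],
   [0,67,131,278], [0,71,110,246], [0,72,158,217], [0,73,164,401], [0,74,293,399],
   [0,75,241,407], [0,78,214,349], [0,79,123,240], [0,83,105,252], [0,86,292,347],
   [0,88,202,404], [0,91,276,290], [0,94,154,160], [0,97,156,275], [0,98,145,343],
   [0,100,233,259], [0,101,234,331], [0,103,201,409], [0,104,168,188], [0,108,227,302],
   [0,116,197,205], [0,117,204,408], [0,119,348,384], [0,125,307,391], [0,126,134,339],
   [0,128,144,321], [0,129,314,382], [0,137,151,235], [0,138,192,258], [0,142,169,194],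
   [0,148,248,269], [0,149,313,342], [0,163,178,191], [0,172,268,312], [0,176,368,393],
   [0,177,277,372], [0,179,337,418], [0,183,279,287], [0,186,261,284], [0,203,289,394],
   [0,221,364,369], [0,229,263,298], [0,231,294,346], [0,286,328,389], [0,304,351,358],
   [1,4,147,219], [1,6,159,266], [1,11,124,314], [1,13,191,224], [1,14,156,384], [1,16,152,359],
   [1,17,316,382], [1,18,86,164], [1,19,78,273], [1,21,323,383], [1,23,136,334], [1,26,153,308],
   [1,27,38,194], [1,28,158,386], [1,29,197,213], [1,32,142,366], [1,36,208,272], [1,37,49,312],
   [1,39,239,387], [1,42,172,381], [1,44,133,216], [1,47,168,393], [1,48,62,88], [1,51,131,336],
   [1,52,89,298], [1,53,228,352], [1,54,187,322], [1,56,118,354], [1,57,66,292], [1,59,73,112],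
   [1,69,242,418], [1,84,188,372], [1,93,183,353], [1,102,108,388], [1,103,106,337],
   [1,117,288,414], [1,119,182,369], [1,122,151,403], [1,123,222,407], [1,129,324,357],
   [1,138,143,162], [1,163,238,373], [1,174,184,201], [1,178,263,368], [1,179,203,392],
   [1,212,268,408], [1,247,269,349], [1,259,278,287], [1,274,297,389], [1,279,294,419],
   [1,282,333,404], [1,307,339,378], [1,309,402,422], [2,7,52,312], [2,9,119,322],
   [2,12,92,353], [2,27,219,289], [2,32,63,129], [2,37,168,309], [2,42,203,369], [2,43,84,362],
   [2,48,113,267], [2,59,228,339], [2,64,154,319], [2,72,188,218], [2,87,229,423],
   [2,93,202,358], [2,134,179,217], [2,138,253,378], [2,239,304,324], [2,349,384,424],
   [3,9,304,383], [3,59,179,208], [3,73,154,424]]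
  []"
  by code_simp

lemma family_141: "valid_family 141 2
  [[1,15,37,427], [1,391,413,427]]
  [[0,3,55,329], [0,4,356,398], [0,5,189,286], [0,6,107,161], [0,7,120,205], [0,8,95,207],
   [0,9,68,307], [0,10,182,330], [0,11,57,126], [0,12,137,165], [0,13,244,380], [0,17,269,346],
   [0,18,251,254], [0,19,270,311], [0,20,260,423], [0,21,112,193], [0,23,47,196], [0,24,49,128],
   [0,26,65,327], [0,27,365,384], [0,28,262,294], [0,29,200,309], [0,31,183,419],
   [0,33,129,312], [0,35,92,375], [0,40,123,298], [0,43,94,169], [0,45,176,282], [0,46,102,190],
   [0,50,103,164], [0,51,93,364], [0,52,225,274], [0,54,167,241], [0,58,124,343],
   [0,59,247,278], [0,60,235,417], [0,62,293,310], [0,63,203,218], [0,67,117,160],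
   [0,69,281,318], [0,70,211,373], [0,73,151,421], [0,74,213,341], [0,77,181,290],
   [0,78,263,395], [0,79,105,306], [0,80,212,355], [0,84,224,383], [0,86,323,381],
   [0,89,195,230], [0,90,242,333], [0,96,217,361], [0,97,131,220], [0,100,271,389],
   [0,111,261,321], [0,119,127,202], [0,135,291,363], [0,145,325,387], [0,156,405,415],
   [0,178,401,407], [0,221,277,399], [1,5,87,313], [1,13,233,397], [1,19,67,161], [1,21,85,195],
   [1,31,99,321], [1,71,205,329], [1,77,191,337]]
  [(0,133)]"
  by code_simp

lemma family_149: "valid_family 149 2
  [[1,97,185,451], [1,267,355,451]]
  [[0,3,128,150], [0,4,197,394], [0,5,89,99], [0,6,160,355], [0,7,86,326], [0,8,36,241],
   [0,9,44,167], [0,10,69,213], [0,11,281,313], [0,12,137,285], [0,13,303,319], [0,14,30,253],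
   [0,15,397,434], [0,17,220,320], [0,19,361,378], [0,20,144,433], [0,21,68,162],
   [0,23,214,348], [0,24,181,190], [0,25,73,208], [0,26,161,304], [0,27,102,379],
   [0,29,325,406], [0,31,182,341], [0,32,115,200], [0,34,228,265], [0,35,41,386],
   [0,38,179,236], [0,39,246,357], [0,40,121,362], [0,42,272,382], [0,43,279,307],
   [0,45,79,380], [0,47,103,156], [0,48,257,423], [0,49,242,381], [0,50,169,383],
   [0,51,177,332], [0,52,204,411], [0,53,191,306], [0,54,145,314], [0,55,78,299],
   [0,56,178,336], [0,57,71,391], [0,60,347,425], [0,61,82,147], [0,63,105,264], [0,64,229,346],
   [0,67,315,427], [0,76,219,263], [0,77,92,234], [0,80,276,449], [0,84,321,351],
   [0,85,109,189], [0,87,247,387], [0,95,131,312], [0,108,323,439], [0,113,202,338],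
   [0,118,393,447], [0,129,155,401], [0,153,403,441], [0,163,175,385], [0,164,389,407],
   [0,201,291,421], [0,217,339,445], [0,345,353,419], [1,5,175,393], [1,21,193,371],
   [1,23,191,403], [1,41,339,385], [1,53,177,377], [1,59,255,317]]
  [(0,409)]"
  by code_simp

lemma family_157: "valid_family 157 2
  [[1,71,305,475], [1,171,405,475]]
  [[0,3,226,292], [0,4,318,360], [0,5,196,364], [0,6,47,383], [0,7,136,237], [0,8,20,183],
   [0,9,140,262], [0,10,293,322], [0,11,24,69], [0,13,107,450], [0,14,181,291], [0,15,34,425],
   [0,16,227,294], [0,17,254,459], [0,18,80,221], [0,19,78,444], [0,21,189,228], [0,22,111,471],
   [0,23,145,376], [0,25,75,87], [0,27,108,374], [0,28,365,422], [0,29,348,384], [0,30,246,349],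
   [0,31,135,352], [0,33,43,197], [0,35,178,334], [0,37,265,453], [0,38,427,467],
   [0,40,339,382], [0,44,192,287], [0,46,401,405], [0,48,152,321], [0,49,268,412],
   [0,50,126,361], [0,52,316,431], [0,53,118,421], [0,55,206,353], [0,56,114,199],
   [0,57,73,220], [0,59,241,310], [0,60,309,386], [0,61,86,174], [0,63,146,255], [0,65,200,274],
   [0,67,272,370], [0,68,193,443], [0,77,97,344], [0,79,335,338], [0,81,176,455],
   [0,83,232,323], [0,84,297,315], [0,93,219,301], [0,96,247,282], [0,99,188,373],
   [0,105,179,385], [0,127,275,403], [0,130,289,331], [0,131,236,469], [0,137,296,461],
   [0,139,207,218], [0,149,190,343], [0,161,307,351], [0,171,263,295], [0,191,215,252],
   [0,195,251,369], [0,261,423,445], [0,281,367,413], [1,7,363,447], [1,9,219,319],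
   [1,15,91,145], [1,27,291,343], [1,29,107,205], [1,39,255,335], [1,49,113,327], [1,89,225,321]]
  [(0,357)]"
  by code_simp

lemma family_160: "valid_family 160 5
  [[1,2,5,480], [2,3,131,484], [42,56,354,483], [175,310,429,483], [180,305,443,482]]
  [[0,8,142,154], [0,9,339,349], [0,11,30,434], [0,12,91,149], [0,13,166,265], [0,14,234,391],
   [0,15,381,431], [0,16,72,263], [0,17,280,378], [0,18,165,187], [0,19,360,423],
   [0,20,188,318], [0,21,164,362], [0,23,335,361], [0,24,195,432], [0,25,153,270],
   [0,27,146,160], [0,28,105,279], [0,29,312,409], [0,31,96,405], [0,32,243,468], [0,33,89,224],
   [0,34,218,419], [0,35,190,293], [0,36,238,317], [0,37,46,430], [0,38,182,228],
   [0,39,241,364], [0,40,328,467], [0,41,75,268], [0,42,159,162], [0,43,442,478],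
   [0,45,217,392], [0,47,302,374], [0,48,309,406], [0,49,69,139], [0,50,127,344],
   [0,51,110,204], [0,52,65,479], [0,53,135,225], [0,54,329,341], [0,56,267,319],
   [0,57,372,453], [0,59,147,424], [0,60,198,266], [0,61,202,444], [0,62,282,303],
   [0,64,79,257], [0,66,104,286], [0,67,196,447], [0,68,336,473], [0,70,443,446],
   [0,71,192,389], [0,73,186,400], [0,74,100,275], [0,76,113,261], [0,78,358,469],
   [0,81,191,213], [0,82,88,264], [0,83,388,463], [0,84,291,421], [0,86,248,278],
   [0,87,323,422], [0,93,181,370], [0,95,221,458], [0,97,246,255], [0,99,226,249],
   [0,102,254,340], [0,106,119,483], [0,107,203,353], [0,108,131,397], [0,109,156,334],
   [0,112,345,474], [0,114,438,448], [0,116,133,137], [0,117,199,417], [0,118,184,437],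
   [0,120,382,412], [0,121,285,428], [0,122,287,398], [0,123,277,281], [0,124,170,359],
   [0,130,413,452], [0,134,197,357], [0,136,169,343], [0,141,342,429], [0,148,212,407],
   [0,151,235,418], [0,152,180,387], [0,157,223,436], [0,161,185,484], [0,163,211,367],
   [0,167,449,456], [0,171,231,383], [0,177,242,369], [0,178,348,441], [0,179,326,394],
   [0,194,269,311], [0,201,253,337], [0,209,259,454], [0,214,384,462], [0,216,354,379],
   [0,219,411,477], [0,227,251,396], [0,229,306,324], [0,232,273,308], [0,236,289,316],
   [0,239,304,371], [0,244,276,377], [0,256,307,333], [0,272,301,393], [0,274,297,346],
   [0,331,402,464], [0,332,351,433], [1,6,237,311], [1,7,99,303], [1,8,249,348], [1,9,168,443],
   [1,11,241,441], [1,12,101,472], [1,13,98,229], [1,16,136,291], [1,17,87,281], [1,21,117,127],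
   [1,26,96,172], [1,27,94,129], [1,28,191,473], [1,29,401,484], [1,31,143,219], [1,32,158,353],
   [1,33,336,408], [1,36,76,396], [1,37,194,413], [1,42,226,468], [1,43,112,263],
   [1,44,162,343], [1,47,214,233], [1,48,108,399], [1,49,104,141], [1,58,119,258],
   [1,62,236,422], [1,63,469,478], [1,64,68,88], [1,74,123,429], [1,79,161,358], [1,82,368,383],
   [1,89,118,316], [1,92,216,442], [1,103,428,464], [1,106,297,392], [1,116,274,377],
   [1,152,167,427], [1,169,209,322], [1,173,244,352], [1,177,234,277], [1,182,327,382],
   [1,204,242,293], [1,217,363,379], [1,224,257,388], [1,239,298,332], [1,247,452,453],
   [1,253,318,344], [1,254,364,403], [1,269,349,423], [1,272,347,387], [1,278,299,307],
   [1,314,433,458], [1,334,417,448], [1,374,402,434], [2,4,253,259], [2,7,24,344],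
   [2,9,218,273], [2,13,114,313], [2,18,49,118], [2,22,158,163], [2,29,47,268], [2,37,209,468],
   [2,39,87,478], [2,52,242,397], [2,62,274,443], [2,63,179,319], [2,73,304,357],
   [2,82,173,338], [2,108,182,473], [2,109,272,419], [2,112,254,299], [2,124,178,314],
   [2,134,249,463], [2,263,389,474], [2,328,373,414], [3,14,98,333], [3,93,199,233],
   [3,99,379,384], [3,118,299,363], [3,144,273,444]]
  []"
  by code_simp

lemma family_165: "valid_family 165 2
  [[1,351,393,499], [1,107,149,499]]
  [[0,3,179,198], [0,4,377,421], [0,5,290,368], [0,6,21,123], [0,7,72,404], [0,8,141,323],
   [0,9,155,208], [0,10,50,244], [0,11,75,213], [0,12,131,265], [0,13,280,310], [0,14,138,482],
   [0,16,278,418], [0,17,62,405], [0,19,346,476], [0,20,212,313], [0,22,83,389], [0,23,163,326],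
   [0,25,276,452], [0,26,146,299], [0,27,207,464], [0,28,358,453], [0,29,44,270],
   [0,31,444,483], [0,33,189,328], [0,34,93,416], [0,35,258,451], [0,37,115,443],
   [0,38,202,385], [0,41,316,396], [0,45,76,263], [0,46,349,449], [0,47,471,491],
   [0,49,162,297], [0,51,229,334], [0,52,240,467], [0,53,296,406], [0,54,365,432],
   [0,55,248,413], [0,57,97,436], [0,58,319,487], [0,60,339,400], [0,65,186,335],
   [0,66,178,289], [0,67,129,246], [0,69,327,430], [0,71,214,304], [0,74,345,497],
   [0,77,116,479], [0,79,102,284], [0,81,144,412], [0,85,348,457], [0,86,371,445],
   [0,89,264,431], [0,91,128,287], [0,92,291,364], [0,99,157,209], [0,105,143,374],
   [0,107,251,381], [0,113,366,493], [0,114,353,369], [0,125,218,409], [0,151,275,465],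
   [0,158,329,399], [0,175,211,300], [0,180,401,489], [0,181,206,391], [0,195,355,473],
   [0,201,283,317], [0,219,333,419], [0,235,441,459], [0,281,331,341], [1,5,213,317],
   [1,7,247,337], [1,9,33,265], [1,13,309,339], [1,15,287,379], [1,23,303,369], [1,27,73,447],
   [1,29,97,263]]
  [(0,245)]"
  by code_simp

lemma family_173: "valid_family 173 2
  [[1,319,327,523], [1,197,205,523]]
  [[0,3,309,476], [0,4,352,412], [0,5,154,471], [0,6,455,506], [0,7,236,503], [0,9,382,454],
   [0,10,39,125], [0,11,221,277], [0,12,354,444], [0,13,445,469], [0,14,338,472],
   [0,15,287,429], [0,16,144,374], [0,17,344,422], [0,19,30,273], [0,20,240,425],
   [0,21,181,242], [0,22,105,153], [0,23,159,438], [0,25,203,265], [0,26,81,263],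
   [0,27,251,322], [0,28,117,363], [0,31,360,495], [0,32,155,173], [0,33,289,475],
   [0,34,258,426], [0,35,47,216], [0,36,351,484], [0,37,209,279], [0,38,139,239],
   [0,41,280,339], [0,42,247,387], [0,43,227,435], [0,44,219,334], [0,45,158,349],
   [0,46,184,456], [0,49,383,417], [0,50,465,517], [0,53,62,133], [0,54,174,442],
   [0,56,208,418], [0,57,95,171], [0,58,145,149], [0,61,336,479], [0,63,165,364],
   [0,64,157,395], [0,65,161,296], [0,67,178,403], [0,69,333,477], [0,73,156,430],
   [0,74,222,306], [0,75,297,330], [0,77,399,497], [0,85,255,286], [0,88,257,400],
   [0,96,371,401], [0,97,215,427], [0,99,246,499], [0,100,283,437], [0,103,394,507],
   [0,104,231,414], [0,107,397,439], [0,108,271,421], [0,111,137,276], [0,118,311,419],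
   [0,121,259,298], [0,122,487,501], [0,126,361,433], [0,129,332,519], [0,140,431,509],
   [0,146,353,407], [0,147,211,299], [0,177,213,254], [0,179,260,459], [0,217,393,505],
   [0,241,367,457], [0,281,461,481], [0,329,373,423], [0,489,511,521], [1,7,363,403],
   [1,17,175,249], [1,47,131,297], [1,67,215,361]]
  [(0,189)]"
  by code_simp

lemma family_180: "valid_family 180 5
  [[1,2,5,540], [2,3,231,544], [92,311,314,543], [225,234,320,543], [230,315,453,542]]
  [[0,8,64,192], [0,9,242,466], [0,11,123,297], [0,12,222,444], [0,13,115,372], [0,14,311,387],
   [0,15,134,299], [0,16,172,255], [0,17,211,427], [0,18,258,455], [0,19,359,511],
   [0,20,105,268], [0,21,280,398], [0,22,495,534], [0,23,77,355], [0,24,141,159], [0,25,58,428],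
   [0,26,45,345], [0,27,312,524], [0,28,92,254], [0,29,277,413], [0,30,96,397], [0,31,171,446],
   [0,32,164,388], [0,34,70,392], [0,35,102,467], [0,36,62,78], [0,37,74,156], [0,38,52,307],
   [0,40,418,476], [0,41,187,438], [0,42,434,513], [0,43,130,459], [0,44,136,442],
   [0,46,452,470], [0,47,170,532], [0,48,327,347], [0,49,83,324], [0,51,106,143],
   [0,53,135,370], [0,54,271,330], [0,55,131,506], [0,56,162,365], [0,57,184,206],
   [0,59,110,295], [0,60,188,261], [0,61,214,266], [0,63,133,177], [0,65,400,538],
   [0,68,91,478], [0,69,140,289], [0,71,196,314], [0,73,321,346], [0,79,247,464],
   [0,80,193,496], [0,81,218,328], [0,82,208,424], [0,84,216,390], [0,86,109,225],
   [0,87,168,288], [0,88,137,423], [0,89,219,369], [0,93,238,404], [0,95,332,380],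
   [0,97,142,240], [0,98,217,421], [0,99,337,395], [0,100,343,393], [0,101,223,276],
   [0,103,166,315], [0,104,160,318], [0,107,379,399], [0,111,181,484], [0,112,282,439],
   [0,114,381,516], [0,116,453,508], [0,117,173,221], [0,120,264,504], [0,122,198,234],
   [0,124,454,544], [0,125,419,479], [0,126,203,246], [0,127,273,334], [0,129,376,407],
   [0,132,283,482], [0,139,178,197], [0,146,167,220], [0,147,368,507], [0,148,278,340],
   [0,151,195,539], [0,152,331,409], [0,153,157,357], [0,154,502,528], [0,161,241,503],
   [0,169,212,468], [0,174,358,517], [0,176,303,411], [0,179,301,391], [0,182,338,529],
   [0,183,191,498], [0,186,394,512], [0,189,356,389], [0,194,262,426], [0,199,287,361],
   [0,202,256,270], [0,204,279,374], [0,207,308,441], [0,209,224,533], [0,227,292,364],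
   [0,229,352,518], [0,231,456,514], [0,233,412,519], [0,244,281,469], [0,251,481,488],
   [0,252,383,461], [0,253,298,448], [0,259,263,417], [0,272,349,522], [0,274,437,543],
   [0,291,377,386], [0,296,336,363], [0,302,351,373], [0,304,339,366], [0,317,401,537],
   [0,319,382,433], [0,323,457,536], [0,326,449,521], [0,341,472,493], [0,408,414,523],
   [0,431,491,499], [1,6,203,229], [1,7,242,419], [1,11,274,372], [1,12,111,366], [1,13,52,219],
   [1,14,269,282], [1,16,116,309], [1,17,368,469], [1,18,47,108], [1,21,168,463], [1,29,48,428],
   [1,31,97,501], [1,33,247,461], [1,36,199,318], [1,37,177,482], [1,39,188,381],
   [1,42,172,201], [1,44,331,433], [1,49,98,527], [1,51,159,423], [1,53,158,477],
   [1,57,253,328], [1,58,167,359], [1,62,186,396], [1,63,169,272], [1,64,174,544],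
   [1,66,252,267], [1,72,297,502], [1,73,403,449], [1,74,357,439], [1,82,134,369],
   [1,83,326,504], [1,84,129,218], [1,88,112,348], [1,92,214,508], [1,94,178,277],
   [1,99,104,173], [1,102,182,363], [1,106,391,542], [1,114,278,364], [1,117,392,432],
   [1,122,266,522], [1,127,418,448], [1,133,487,518], [1,139,452,453], [1,143,161,401],
   [1,149,409,412], [1,162,377,399], [1,163,254,301], [1,183,251,489], [1,184,191,534],
   [1,193,258,529], [1,197,207,292], [1,208,213,349], [1,222,339,383], [1,227,317,533],
   [1,233,358,513], [1,262,289,404], [1,268,293,444], [1,313,434,514], [1,347,507,512],
   [1,354,459,532], [1,417,458,479], [2,4,14,519], [2,8,157,453], [2,9,152,478], [2,13,283,464],
   [2,19,208,378], [2,27,468,488], [2,32,184,243], [2,34,57,513], [2,37,339,529], [2,38,98,472],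
   [2,44,68,469], [2,48,192,439], [2,49,99,303], [2,52,122,422], [2,59,233,244], [2,89,282,423],
   [2,93,178,383], [2,104,112,509], [2,107,334,359], [3,13,129,193], [3,18,99,203],
   [3,19,264,513], [3,34,134,313], [3,43,389,534], [3,44,114,143], [3,74,83,303],
   [3,199,354,409]]
  []"
  by code_simp

theorem lemma3p2:
  fixes r :: nat
  assumes "r \<in> {29, 33, 37, 40, 45, 49, 52, 53, 60, 61, 65, 69, 77, 80, 81, 85, 93, 97,
    100, 101, 108, 109, 117, 120, 125, 133, 140, 141, 149, 157, 160, 165, 173, 180}"
  shows "\<exists>(P :: nat set) L. pentagonal_geometry P L 4 r
    \<and> (\<nexists>l m. opposite_line_pair P L l m)
    \<and> Digraph_Component.connected (deficiency_graph P L)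
    \<and> girth (deficiency_graph P L) \<ge> 5"
proof -
  note families = family_29 family_33 family_37 family_40 family_45 family_49 family_52
    family_53 family_60 family_61 family_65 family_69 family_77 family_80 family_81 family_85
    family_93 family_97 family_100 family_101 family_108 family_109 family_117 family_120
    family_125 family_133 family_140 family_141 family_149 family_157 family_160 family_165
    family_173 family_180
  show ?thesis
    using assms families[THEN realizableI] unfolding pentagonal_realizable_def[symmetric] by blast
qed

end
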